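(* For $\lambda\in\mathbb{C}$ with $0<|\lambda|<1$, let $$\phi_1(z):=z^2\,\frac{z-\lambda}{1-\overline{\lambda}z}\quad\text{and}\quad \phi_2(z):=z\left(\frac{z-\lambda}{1-\overline{\lambda}z}\right)^2,$$ and let $\phi_0(z):=z^3$. Then $\phi_1$ is mixing at a double exponential rate, but $\phi_2$ is not. For small $\lambda$, both $\phi_1$ and $\phi_2$ are $C^1$-perturbations of $\phi_0$: there exist constants $C>0$ and $\delta\in(0,1)$ such that $d_{C^1}(\phi_i,\phi_0)\le C|\lambda|$ for $i=1,2$ whenever $0<|\lambda|<\delta$. However, for $0<|\lambda|<1$, neither $\phi_1$ nor $\phi_2$ is $C^1$-conjugate to $\phi_0$.
   Context: $\mathbb{S}^1=\{|z|=1\}$, $d\mu(z)=\frac{1}{2\pi i}\frac{dz}{z}$ is normalized Lebesgue measure on $\mathbb{S}^1$; all of the maps above map $\mathbb{S}^1$ to itself and preserve $\mu$. $d_{C^1}(\phi,\widetilde\phi):=\sup_{z\in\mathbb{S}^1}|\phi(z)-\widetilde\phi(z)|+\sup_{z\in\mathbb{S}^1}|\phi'(z)-\widetilde\phi'(z)|$. Two maps $\phi,\widetilde\phi:\mathbb{S}^1\to\mathbb{S}^1$ are $C^1$-conjugate if there is a $C^1$-diffeomorphism $h:\mathbb{S}^1\to\mathbb{S}^1$ with $\phi\circ h=h\circ\widetilde\phi$. For $0<\theta<1$, $\mathcal{H}_\theta$ is the closure of the linear combinations of $z^k$, $k\in\mathbb{Z}$, with respect to $\|f\|_\theta=\sqrt{\sum_{k\in\mathbb{Z}}|f_k|^2\theta^{-2|k|}}$,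 where $f_k$ are the Fourier coefficients of $f$. A $\mu$-preserving map $\phi$ is mixing at a double exponential rate if for some $0<\theta<1$ there exist $\beta,\gamma,C>0$ such that for all $f,g\in\mathcal{H}_\theta$ and all $n\ge1$, $\left|\int_{\mathbb{S}^1}(f\circ\phi^n)\,\overline{g}\,d\mu-\int_{\mathbb{S}^1}f\,d\mu\int_{\mathbb{S}^1}\overline{g}\,d\mu\right|\le Ce^{-\beta e^{\gamma n}}\|f\|_\theta\|g\|_\theta$, where $\phi^n$ is the $n$-fold iterate. *)

theory Defs
  imports "HOL-Complex_Analysis.Complex_Analysis"
begin

text \<open>Maps and observables on the unit circle are functions on \<open>complex\<close>; only their values on
  the circle matter.\<close>

abbreviation circle :: "complex set" where
  "circle \<equiv> sphere 0 1"

text \<open>Integration against \<open>d\<mu> = dz / (2 \<pi> i z)\<close>. It is applied to functions that are continuous on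
  the circle only, where the contour integral agrees with the Lebesgue integral.\<close>

definition circle_integral :: "(complex \<Rightarrow> complex) \<Rightarrow> complex" where
  "circle_integral f =
     1 / (2 * of_real pi * \<i>) * contour_integral (circlepath 0 1) (\<lambda>z. f z / z)"

definition fourier_coeff :: "(complex \<Rightarrow> complex) \<Rightarrow> int \<Rightarrow> complex" where
  "fourier_coeff f k = circle_integral (\<lambda>z. f z * z powi (- k))"

definition laurent_polynomials :: "(complex \<Rightarrow> complex) set" where
  "laurent_polynomials =
     {p. \<exists>K c. finite K \<and> p = (\<lambda>z. \<Sum>k\<in>K. c k * z powi (k::int))}"

definition finite_norm_theta :: "real \<Rightarrow> (complex \<Rightarrow> complex) \<Rightarrow> bool" where
  "finite_norm_theta \<theta> f \<longleftrightarrow>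
     (\<lambda>k. (cmod (fourier_coeff f k))\<^sup>2 * \<theta> powi (- 2 * \<bar>k\<bar>)) summable_on UNIV"

text \<open>Meaningful only under \<open>finite_norm_theta \<theta> f\<close>, since \<open>infsum\<close> is 0 for divergent sums.\<close>

definition norm_theta :: "real \<Rightarrow> (complex \<Rightarrow> complex) \<Rightarrow> real" where
  "norm_theta \<theta> f =
     sqrt (\<Sum>\<^sub>\<infinity>k\<in>UNIV. (cmod (fourier_coeff f k))\<^sup>2 * \<theta> powi (- 2 * \<bar>k\<bar>))"

text \<open>The closure of the Laurent polynomials. For \<open>0 < \<theta> < 1\<close> a sequence that is Cauchy for
  \<open>norm_theta \<theta>\<close> converges uniformly on the circle, so the elements of the completion are continuous
  functions on the circle, determined by their Fourier coefficients.\<close>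

definition H_theta :: "real \<Rightarrow> (complex \<Rightarrow> complex) set" where
  "H_theta \<theta> =
     {f. continuous_on circle f \<and>
         (\<forall>\<epsilon>>0. \<exists>p\<in>laurent_polynomials.
            finite_norm_theta \<theta> (\<lambda>z. f z - p z) \<and> norm_theta \<theta> (\<lambda>z. f z - p z) < \<epsilon>)}"

text \<open>A property of maps of the circle to itself that preserve \<open>\<mu>\<close>.\<close>

definition double_exp_mixing :: "(complex \<Rightarrow> complex) \<Rightarrow> bool" where
  "double_exp_mixing \<phi> \<longleftrightarrow>
     (\<exists>\<theta>. 0 < \<theta> \<and> \<theta> < 1 \<and>
       (\<exists>\<beta> \<gamma> C :: real. \<beta> > 0 \<and> \<gamma> > 0 \<and> C > 0 \<and>
         (\<forall>f\<in>H_theta \<theta>. \<forall>g\<in>H_theta \<theta>. \<forall>n\<ge>1.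
            cmod (circle_integral (\<lambda>z. f ((\<phi> ^^ n) z) * cnj (g z))
                  - circle_integral f * circle_integral (\<lambda>z. cnj (g z)))
            \<le> C * exp (- \<beta> * exp (\<gamma> * real n)) * norm_theta \<theta> f * norm_theta \<theta> g)))"

text \<open>The derivative of a map defined on the circle is the limit of difference quotients along the
  circle. This is ordinary differentiability in the angular coordinate (the circle has a
  one-dimensional tangent space), and it is the complex derivative if the map is holomorphic
  near the point.\<close>

definition circle_deriv :: "(complex \<Rightarrow> complex) \<Rightarrow> complex \<Rightarrow> complex" where
  "circle_deriv \<phi> z = (SOME D. (\<phi> has_field_derivative D) (at z within circle))"

lemma circle_deriv_eqI:
  assumes "z \<in> circle" and D: "(\<phi> has_field_derivative D) (at z within circle)"
  shows "circle_deriv \<phi> z = D"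
proof -
  have "- z \<in> circle" "- z \<noteq> z"
    using assms(1) by auto
  then have "\<nexists>x. circle = {x}"
    using assms(1) by (metis singletonD)
  then have "z islimpt circle"
    using assms(1) connected_sphere[of "0::complex" 1]
    by (intro connected_imp_perfect) auto
  then have "at z within circle \<noteq> bot"
    by (simp add: trivial_limit_within)
  moreover have "(\<phi> has_field_derivative circle_deriv \<phi> z) (at z within circle)"
    unfolding circle_deriv_def using D by (rule someI)
  ultimately show ?thesis
    using D by (auto simp: has_field_derivative_iff intro: tendsto_unique)
qed

lemma circle_deriv_holomorphic:
  assumes "z \<in> circle" "\<phi> holomorphic_on A" "open A" "z \<in> A"
  shows "circle_deriv \<phi> z = deriv \<phi> z"
  using assms
  by (intro circle_deriv_eqI) (auto intro: has_field_derivative_at_within holomorphic_derivI)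

definition C1_on_circle :: "(complex \<Rightarrow> complex) \<Rightarrow> bool" where
  "C1_on_circle h \<longleftrightarrow>
     (\<exists>h'. continuous_on circle h' \<and>
           (\<forall>z\<in>circle. (h has_field_derivative h' z) (at z within circle)))"

definition C1_diffeo_circle :: "(complex \<Rightarrow> complex) \<Rightarrow> bool" where
  "C1_diffeo_circle h \<longleftrightarrow>
     bij_betw h circle circle \<and> C1_on_circle h \<and> C1_on_circle (inv_into circle h)"

definition C1_conjugate :: "(complex \<Rightarrow> complex) \<Rightarrow> (complex \<Rightarrow> complex) \<Rightarrow> bool" where
  "C1_conjugate \<phi> \<psi> \<longleftrightarrow>
     (\<exists>h. C1_diffeo_circle h \<and> (\<forall>z\<in>circle. \<phi> (h z) = h (\<psi> z)))"

text \<open>For \<open>\<phi>\<close> and \<open>\<psi>\<close> that are \<open>C\<^sup>1\<close> on the circle both suprema are over bounded sets.\<close>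

definition dist_C1 :: "(complex \<Rightarrow> complex) \<Rightarrow> (complex \<Rightarrow> complex) \<Rightarrow> real" where
  "dist_C1 \<phi> \<psi> =
     (SUP z\<in>circle. cmod (\<phi> z - \<psi> z)) +
     (SUP z\<in>circle. cmod (circle_deriv \<phi> z - circle_deriv \<psi> z))"

definition phi0 :: "complex \<Rightarrow> complex" where
  "phi0 z = z ^ 3"

definition phi1 :: "complex \<Rightarrow> complex \<Rightarrow> complex" where
  "phi1 lam z = z\<^sup>2 * ((z - lam) / (1 - cnj lam * z))"

definition phi2 :: "complex \<Rightarrow> complex \<Rightarrow> complex" where
  "phi2 lam z = z * ((z - lam) / (1 - cnj lam * z))\<^sup>2"

end

theory Submission
  imports Defs "HOL-Real_Asymp.Real_Asymp"
begin

text \<open>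
  Write \<open>b\<close> for the Moebius map \<open>(z - lam) / (1 - cnj lam * z)\<close>, so that the two maps are \<open>z\<^sup>2 * b\<close> and
  \<open>z * b\<^sup>2\<close>. Both extend analytically to the closed disc, map it into itself and fix 0. What separates them is
  the order of vanishing at 0.

  For \<open>z\<^sup>2 * b\<close> the fixed point is critical, and the \<open>n\<close>-th iterate vanishes there to order \<open>2 ^ n\<close>. By the
  mean value property a nonzero power of the iterate is then orthogonal to every \<open>z powi j\<close> with
  \<open>\<bar>j\<bar> < 2 ^ n\<close>. An observable of finite norm has coefficients bounded by a multiple of \<open>\<theta> ^ \<bar>j\<bar>\<close> and is the sum of its
  Fourier series, so its correlations after \<open>n\<close> steps are of size \<open>\<theta> ^ (2 ^ n)\<close> up to constants
  (\<open>double_exp_mixing_critical_fixed_point\<close>). That a continuous function is the sum of its series needs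
  uniqueness of Fourier coefficients, which is derived from the Stone-Weierstrass theorem
  (\<open>null_fourier_imp_zero\<close>). For \<open>z * b\<^sup>2\<close> the multiplier at 0 is \<open>b(0)\<^sup>2 = lam\<^sup>2 \<noteq> 0\<close>, and the
  observable \<open>z\<close> has autocorrelation \<open>lam ^ (2 * n)\<close>, which decays only exponentially
  (\<open>not_double_exp_mixing_noncritical_fixed_point\<close>).

  Nearness to the cube map follows from \<open>\<bar>b(z) - z\<bar> \<le> 4 \<bar>lam\<bar>\<close> and \<open>\<bar>b'(z) - 1\<bar> \<le> 12 \<bar>lam\<bar>\<close> on the circle.

  Multipliers at fixed points do not exclude a conjugacy to the cube map: for purely imaginary \<open>lam\<close> the
  fixed points of \<open>z\<^sup>2 * b\<close> on the circle have multiplier 3, as those of the cube map do. Instead invariance of the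
  measure is used. For each of the two maps the inverses of the speeds \<open>\<bar>\<phi>'\<bar>\<close> at the three preimages of a
  point of the circle add up to 1 (\<open>transfer_weights_sum_one\<close>). Given a conjugacy \<open>h\<close>, the chain rule compares these
  speeds with the constant speed 3 of the cube map through \<open>\<bar>h'\<bar>\<close>; over a point where \<open>\<bar>h'\<bar>\<close> is minimal
  all three speeds are at most 3, hence equal to 3 (\<open>not_C1_conjugate_phi0\<close>). But the speeds are \<open>2 + P\<close> and
  \<open>1 + 2 * P\<close> with the Poisson kernel \<open>P\<close> at \<open>lam\<close>, and \<open>P = 1\<close> holds at no more than two points of the
  circle when \<open>lam \<noteq> 0\<close>.
\<close>

section \<open>Integration against the normalized measure of the circle\<close>

lemma circle_integral_eq_integral:
  "circle_integral f = integral {0..1} (\<lambda>t. f (exp (2 * of_real pi * \<i> * of_real t)))"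
proof -
  have "contour_integral (circlepath 0 1) (\<lambda>z. f z / z)
      = integral {0..1} (\<lambda>t. (2 * of_real pi * \<i>) * f (exp (2 * of_real pi * \<i> * of_real t)))"
    unfolding contour_integral_integral vector_derivative_circlepath
    by (intro integral_cong) (simp add: circlepath)
  then show ?thesis
    by (simp add: circle_integral_def)
qed

lemma continuous_on_circle_param:
  assumes "continuous_on circle f"
  shows "continuous_on A (\<lambda>t. f (exp (2 * of_real pi * \<i> * of_real t)))"
  by (rule continuous_on_compose2[OF assms]) (auto intro!: continuous_intros)

lemma circle_param_surj:
  assumes "z \<in> circle"
  obtains t where "t \<in> {0..1}" "exp (2 * of_real pi * \<i> * of_real t) = z"
proof -
  have "z \<in> path_image (circlepath 0 1)"
    using assms by simp
  then show ?thesis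
    using that by (auto simp: path_image_def circlepath)
qed

lemma circle_integral_cong:
  assumes "\<And>z. z \<in> circle \<Longrightarrow> f z = g z"
  shows "circle_integral f = circle_integral g"
  unfolding circle_integral_eq_integral by (intro integral_cong assms) simp

lemma circle_integral_add:
  assumes "continuous_on circle f" "continuous_on circle g"
  shows "circle_integral (\<lambda>z. f z + g z) = circle_integral f + circle_integral g"
  unfolding circle_integral_eq_integral
  by (intro Henstock_Kurzweil_Integration.integral_add integrable_continuous_interval
            continuous_on_circle_param assms)

lemma circle_integral_diff:
  assumes "continuous_on circle f" "continuous_on circle g"
  shows "circle_integral (\<lambda>z. f z - g z) = circle_integral f - circle_integral g"
  unfolding circle_integral_eq_integral
  by (intro Henstock_Kurzweil_Integration.integral_diff integrable_continuous_interval
            continuous_on_circle_param assms)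

lemma circle_integral_cmult: "circle_integral (\<lambda>z. c * f z) = c * circle_integral f"
  unfolding circle_integral_eq_integral by simp

lemma circle_integral_const [simp]: "circle_integral (\<lambda>z. c) = c"
  unfolding circle_integral_eq_integral by simp

lemma circle_integral_cnj: "circle_integral (\<lambda>z. cnj (f z)) = cnj (circle_integral f)"
  unfolding circle_integral_eq_integral by (simp add: Henstock_Kurzweil_Integration.integral_cnj)

lemma circle_integral_sum:
  assumes "finite X" "\<And>k. k \<in> X \<Longrightarrow> continuous_on circle (f k)"
  shows "circle_integral (\<lambda>z. \<Sum>k\<in>X. f k z) = (\<Sum>k\<in>X. circle_integral (f k))"
  unfolding circle_integral_eq_integral using assms
  by (intro integral_sum integrable_continuous_interval continuous_on_circle_param) auto

lemma cmod_circle_integral_le: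
  assumes "continuous_on circle f" "\<And>z. z \<in> circle \<Longrightarrow> cmod (f z) \<le> B"
  shows "cmod (circle_integral f) \<le> B"
proof -
  have "cmod (circle_integral f) \<le> B * (1 - 0)"
    unfolding circle_integral_eq_integral
    by (intro integral_bound continuous_on_circle_param assms) auto
  then show ?thesis by simp
qed

lemma circle_integral_mean_value:
  assumes "continuous_on (cball 0 1) F" "F holomorphic_on ball 0 1"
  shows "circle_integral F = F 0"
proof -
  have "((\<lambda>z. F z / (z - 0)) has_contour_integral 2 * of_real pi * \<i> * F 0) (circlepath 0 1)"
    using assms by (intro Cauchy_integral_circlepath) auto
  then have "contour_integral (circlepath 0 1) (\<lambda>z. F z / z) = 2 * of_real pi * \<i> * F 0"
    by (simp add: contour_integral_unique)
  then show ?thesis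
    by (simp add: circle_integral_def)
qed

lemma continuous_on_circle_powi [continuous_intros]:
  assumes "continuous_on circle u" "\<And>z. z \<in> circle \<Longrightarrow> u z \<in> circle"
  shows "continuous_on circle (\<lambda>z. u z powi k :: complex)"
  using assms by (intro continuous_intros) fastforce+

lemma circle_inverse_eq_cnj:
  assumes "z \<in> circle"
  shows "inverse z = cnj z"
  using assms by (intro inverse_unique) (simp add: complex_norm_square[symmetric])

lemma cnj_powi_circle:
  assumes "z \<in> circle"
  shows "cnj z powi k = z powi (- k)"
  unfolding circle_inverse_eq_cnj[OF assms, symmetric]
  by (simp add: power_int_minus power_int_inverse)

lemma circle_integral_powi:
  "circle_integral (\<lambda>z. z powi k) = (if k = 0 then 1 else 0)"
proof -
  have pos: "circle_integral (\<lambda>z. z powi k) = 0" if "k > 0" for k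
  proof -
    have "circle_integral (\<lambda>z. z powi k) = circle_integral (\<lambda>z. z ^ nat k)"
      using that by (simp add: power_int_def)
    also have "\<dots> = 0 ^ nat k"
      by (intro circle_integral_mean_value continuous_intros holomorphic_intros)
    finally show ?thesis
      using that by simp
  qed
  have "circle_integral (\<lambda>z. z powi k) = 0" if "k < 0"
  proof -
    have "circle_integral (\<lambda>z. z powi k) = circle_integral (\<lambda>z. cnj (z powi (- k)))"
      by (intro circle_integral_cong) (subst complex_cnj_power_int, subst cnj_powi_circle, auto)
    also have "\<dots> = 0"
      unfolding circle_integral_cnj using pos[of "- k"] that by simp
    finally show ?thesis .
  qed
  then show ?thesis
    using pos by (cases k "0 :: int" rule: linorder_cases) auto
qed

text \<open>Uniform convergence by the M-test, in the form needed for Fourier series: summation is over an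
arbitrary index set, so that two-sided series need no symmetric partial sums.\<close>

lemma circle_integral_has_sum:
  assumes "\<And>k. k \<in> A \<Longrightarrow> continuous_on circle (a k)"
    and "\<And>k z. k \<in> A \<Longrightarrow> z \<in> circle \<Longrightarrow> cmod (a k z) \<le> M k"
    and "M summable_on A"
  shows "continuous_on circle (\<lambda>z. \<Sum>\<^sub>\<infinity>k\<in>A. a k z)"
    and "((\<lambda>k. circle_integral (a k)) has_sum circle_integral (\<lambda>z. \<Sum>\<^sub>\<infinity>k\<in>A. a k z)) A"
proof -
  define F where "F z = (\<Sum>\<^sub>\<infinity>k\<in>A. a k z)" for z
  define G where "G X z = (\<Sum>k\<in>X. a k z)" for X z
  have unif: "uniform_limit circle G F (finite_subsets_at_top A)"
    unfolding F_def[abs_def] G_def[abs_def]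
    by (rule Weierstrass_m_test_general) (use assms in auto)
  have ev: "\<forall>\<^sub>F X in finite_subsets_at_top A. finite X \<and> X \<subseteq> A"
    by (auto intro: eventually_finite_subsets_at_top_weakI)
  have contG: "continuous_on circle (G X)" if "X \<subseteq> A" for X
    unfolding G_def using that assms(1) by (intro continuous_on_sum) auto
  have contF: "continuous_on circle F"
    using eventually_mono[OF ev contG] uniform_limit_theorem[OF _ unif] by simp
  then show "continuous_on circle (\<lambda>z. \<Sum>\<^sub>\<infinity>k\<in>A. a k z)"
    by (simp add: F_def[abs_def])
  have "((\<lambda>X. \<Sum>k\<in>X. circle_integral (a k)) \<longlongrightarrow> circle_integral F) (finite_subsets_at_top A)"
  proof (rule tendstoI)
    fix e :: real assume "e > 0"
    then have "\<forall>\<^sub>F X in finite_subsets_at_top A. \<forall>z\<in>circle. dist (G X z) (F z) < e / 2"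
      using uniform_limitD[OF unif, of "e / 2"] by simp
    with ev show "\<forall>\<^sub>F X in finite_subsets_at_top A.
        dist (\<Sum>k\<in>X. circle_integral (a k)) (circle_integral F) < e"
    proof eventually_elim
      case (elim X)
      have "cmod (circle_integral (\<lambda>z. G X z - F z)) \<le> e / 2"
        using elim contF contG
        by (intro cmod_circle_integral_le continuous_on_diff) (auto simp: dist_norm less_imp_le)
      moreover have "circle_integral (\<lambda>z. G X z - F z) = (\<Sum>k\<in>X. circle_integral (a k)) - circle_integral F"
        using elim contF contG assms(1) unfolding G_def
        by (subst circle_integral_diff) (auto simp: circle_integral_sum subset_iff G_def[abs_def])
      ultimately show ?case
        using \<open>e > 0\<close> by (simp add: dist_norm)
    qed
  qed
  then show "((\<lambda>k. circle_integral (a k)) has_sum circle_integral (\<lambda>z. \<Sum>\<^sub>\<infinity>k\<in>A. a k z)) A"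
    by (simp add: has_sum_def F_def[abs_def])
qed

section \<open>Uniqueness of Fourier coefficients\<close>

definition null_fourier :: "(complex \<Rightarrow> complex) \<Rightarrow> bool" where
  "null_fourier h \<longleftrightarrow> continuous_on circle h \<and> (\<forall>k. fourier_coeff h k = 0)"

lemma null_fourier_shift:
  assumes "null_fourier h"
  shows "null_fourier (\<lambda>z. h z * z powi m)"
  unfolding null_fourier_def fourier_coeff_def
proof (intro conjI allI)
  show "continuous_on circle (\<lambda>z. h z * z powi m)"
    using assms unfolding null_fourier_def
    by (intro continuous_on_mult continuous_on_circle_powi continuous_on_id) auto
  fix k
  have "circle_integral (\<lambda>z. h z * z powi m * z powi - k)
      = circle_integral (\<lambda>z. h z * z powi (- (k - m)))"
  proof (rule circle_integral_cong)
    fix z :: complex assume "z \<in> circle"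
    then have "z \<noteq> 0" by auto
    then show "h z * z powi m * z powi - k = h z * z powi (- (k - m))"
      by (simp add: power_int_add[symmetric] mult.assoc add.commute)
  qed
  also have "\<dots> = 0"
    using assms unfolding null_fourier_def fourier_coeff_def by blast
  finally show "circle_integral (\<lambda>z. h z * z powi m * z powi - k) = 0" .
qed

lemma null_fourier_add:
  assumes "null_fourier f" "null_fourier g"
  shows "null_fourier (\<lambda>z. f z + g z)"
  using assms unfolding null_fourier_def fourier_coeff_def ring_distribs
  by (auto intro!: continuous_on_add circle_integral_add[THEN trans]
      continuous_on_mult continuous_on_circle_powi continuous_on_id)

lemma null_fourier_cmult:
  assumes "null_fourier f"
  shows "null_fourier (\<lambda>z. c * f z)"
  using assms unfolding null_fourier_def fourier_coeff_def mult.assoc circle_integral_cmult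
  by (auto intro!: continuous_on_mult)

lemma null_fourier_cong:
  assumes "null_fourier f" "\<And>z. z \<in> circle \<Longrightarrow> f z = g z"
  shows "null_fourier g"
proof -
  have "continuous_on circle g"
    using assms by (metis null_fourier_def continuous_on_cong)
  moreover have "fourier_coeff g k = fourier_coeff f k" for k
    unfolding fourier_coeff_def by (intro circle_integral_cong) (simp add: assms(2))
  ultimately show ?thesis
    using assms(1) by (simp add: null_fourier_def)
qed

text \<open>On the circle \<open>cnj z = inverse z\<close>, so the real and imaginary parts of \<open>z\<close> are Laurent polynomials,
and multiplication by a Laurent polynomial only shifts and combines Fourier coefficients. This makes
the class of functions with vanishing Fourier coefficients a module over all real polynomials in the
coordinates.\<close>

lemma null_fourier_real_polynomial:
  assumes "real_polynomial_function p" "null_fourier h"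
  shows "null_fourier (\<lambda>z. h z * of_real (p z))"
  using assms
proof (induction arbitrary: h rule: real_polynomial_function.induct)
  case (linear f)
  \<comment> \<open>A real linear functional is \<open>a * z + b * cnj z\<close> with \<open>b = cnj a\<close>.\<close>
  define a where "a = Complex (f 1 / 2) (- f \<i> / 2)"
  define b where "b = Complex (f 1 / 2) (f \<i> / 2)"
  have f: "of_real (f z) = a * z powi 1 + b * z powi - 1" if "z \<in> circle" for z
  proof -
    have "z = Re z *\<^sub>R 1 + Im z *\<^sub>R \<i>"
      by (simp add: complex_eq_iff)
    then have "f z = f (Re z *\<^sub>R 1 + Im z *\<^sub>R \<i>)"
      by (rule arg_cong)
    also have "\<dots> = Re z * f 1 + Im z * f \<i>"
      using bounded_linear.linear[OF linear.hyps] by (simp add: linear_add linear_scale)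
    finally have "f z = Re z * f 1 + Im z * f \<i>" .
    then have "f z = a * z + b * cnj z"
      by (simp add: a_def b_def complex_eq_iff field_simps)
    then show ?thesis
      using circle_inverse_eq_cnj[OF that] by (simp add: power_int_minus)
  qed
  have "null_fourier (\<lambda>z. a * (h z * z powi 1) + b * (h z * z powi - 1))"
    by (intro null_fourier_add null_fourier_cmult null_fourier_shift linear.prems)
  then show ?case
    by (rule null_fourier_cong) (simp add: f algebra_simps)
next
  case (const c)
  then show ?case
    using null_fourier_cmult[of h "of_real c"] by (simp add: mult.commute)
next
  case (add f g)
  then show ?case
    using null_fourier_add by (fastforce simp: ring_distribs)
next
  case (mult f g)
  then show ?case
    by (fastforce simp: mult.assoc[symmetric])
qed

text \<open>Uniqueness of Fourier coefficients. By Stone-Weierstrass \<open>cnj h\<close> is a uniform limit of polynomials in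
the coordinates; each of these integrates to 0 against \<open>h\<close>, hence \<open>\<integral> \<bar>h\<bar>\<^sup>2 d\<mu> = 0\<close>.\<close>

lemma null_fourier_imp_zero:
  assumes "null_fourier h" "z \<in> circle"
  shows "h z = 0"
proof -
  have conth: "continuous_on circle h"
    using assms by (simp add: null_fourier_def)
  obtain B where B: "\<And>w. w \<in> circle \<Longrightarrow> cmod (h w) \<le> B" "B > 0"
  proof -
    have "bounded (h ` circle)"
      using conth by (intro compact_imp_bounded compact_continuous_image) auto
    then show ?thesis
      using that unfolding bounded_pos by blast
  qed
  have "cmod (circle_integral (\<lambda>w. h w * cnj (h w))) \<le> e * B" if e: "e > 0" for e
  proof -
    obtain g where g: "polynomial_function g" "\<And>w. w \<in> circle \<Longrightarrow> cmod (cnj (h w) - g w) < e"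
      using Stone_Weierstrass_polynomial_function[OF compact_sphere continuous_on_cnj[OF conth] e]
      by blast
    have "real_polynomial_function (\<lambda>w. Re (g w))" "real_polynomial_function (\<lambda>w. Im (g w))"
      using g(1) bounded_linear_Re bounded_linear_Im by (auto simp: polynomial_function_def o_def)
    then have "null_fourier (\<lambda>w. h w * of_real (Re (g w)) + \<i> * (h w * of_real (Im (g w))))"
      using assms(1) by (intro null_fourier_add null_fourier_cmult null_fourier_real_polynomial)
    then have "null_fourier (\<lambda>w. h w * g w)"
      by (rule null_fourier_cong) (simp add: complex_eq_iff algebra_simps)
    then have contg: "continuous_on circle (\<lambda>w. h w * g w)"
      and "fourier_coeff (\<lambda>w. h w * g w) 0 = 0"
      by (auto simp: null_fourier_def)
    then have "circle_integral (\<lambda>w. h w * g w) = 0"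
      by (simp add: fourier_coeff_def)
    then have "circle_integral (\<lambda>w. h w * cnj (h w))
        = circle_integral (\<lambda>w. h w * cnj (h w) - h w * g w)"
      using conth contg by (subst circle_integral_diff) (auto intro: continuous_intros)
    also have "cmod \<dots> \<le> e * B"
    proof (rule cmod_circle_integral_le)
      fix w assume w: "w \<in> circle"
      have "cmod (h w * cnj (h w) - h w * g w) = cmod (cnj (h w) - g w) * cmod (h w)"
        by (simp add: norm_mult[symmetric] algebra_simps)
      also have "\<dots> \<le> e * B"
        using g(2)[OF w] B(1)[OF w] that by (intro mult_mono) auto
      finally show "cmod (h w * cnj (h w) - h w * g w) \<le> e * B" .
    qed (use conth contg in \<open>auto intro!: continuous_intros\<close>)
    finally show ?thesis .
  qed
  then have "cmod (circle_integral (\<lambda>w. h w * cnj (h w))) \<le> 0 + e" if "e > 0" for e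
    using that B(2) by (metis add_0 divide_pos_pos less_numeral_extra(3) nonzero_eq_divide_eq)
  then have "circle_integral (\<lambda>w. h w * cnj (h w)) = 0"
    using field_le_epsilon by (metis norm_le_zero_iff)
  define H where "H t = h (exp (2 * of_real pi * \<i> * of_real t))" for t :: real
  have contH: "continuous_on {0..1} H"
    unfolding H_def by (rule continuous_on_circle_param[OF conth])
  have "(\<lambda>t. (cmod (H t))\<^sup>2) integrable_on {0..1}"
    by (intro integrable_continuous_interval continuous_intros contH)
  then have "complex_of_real (integral {0..1} (\<lambda>t. (cmod (H t))\<^sup>2))
      = integral {0..1} (\<lambda>t. of_real ((cmod (H t))\<^sup>2))"
    by (simp add: integral_linear[OF _ bounded_linear_of_real, symmetric] o_def)
  also have "\<dots> = circle_integral (\<lambda>w. h w * cnj (h w))"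
    unfolding circle_integral_eq_integral H_def
    by (intro integral_cong) (rule complex_norm_square)
  also have "\<dots> = 0" by fact
  finally have "integral {0..1} (\<lambda>t. (cmod (H t))\<^sup>2) = 0"
    by simp
  then have "\<forall>t\<in>{0..1}. (cmod (H t))\<^sup>2 = 0"
    by (subst (asm) integral_eq_0_iff) (auto intro!: continuous_intros contH)
  then show ?thesis
    using circle_param_surj[OF assms(2)] unfolding H_def by fastforce
qed

section \<open>Fourier series of the observables\<close>

lemma summable_on_geometric_int:
  fixes t :: real
  assumes "0 \<le> t" "t < 1"
  shows "(\<lambda>k::int. t ^ nat \<bar>k\<bar>) summable_on UNIV"
proof -
  have geo: "(\<lambda>n. t ^ n) summable_on UNIV"
    using assms by (intro norm_summable_imp_summable_on) (simp add: summable_geometric)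
  have UNIV_int: "(UNIV :: int set) = range int \<union> range (\<lambda>n. - int (Suc n))"
  proof (intro set_eqI iffI UNIV_I)
    fix k :: int
    show "k \<in> range int \<union> range (\<lambda>n. - int (Suc n))"
      by (cases k) auto
  qed
  have "((\<lambda>k::int. t ^ nat \<bar>k\<bar>) \<circ> int) summable_on UNIV"
    using geo by (simp add: o_def)
  moreover have "((\<lambda>k::int. t ^ nat \<bar>k\<bar>) \<circ> (\<lambda>n. - int (Suc n))) summable_on UNIV"
  proof -
    have "((\<lambda>k::int. t ^ nat \<bar>k\<bar>) \<circ> (\<lambda>n. - int (Suc n))) = (\<lambda>n. t * t ^ n)"
      by (auto simp: fun_eq_iff nat_add_distrib)
    then show ?thesis
      using summable_on_cmult_right[OF geo, of t] by simp
  qed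
  ultimately show ?thesis
    unfolding UNIV_int
    by (intro summable_on_Un_disjoint) (auto simp: summable_on_reindex inj_def)
qed

lemma fourier_coeff_laurent_polynomial:
  assumes "finite K"
  shows "fourier_coeff (\<lambda>z. \<Sum>k\<in>K. c k * z powi k) m = (if m \<in> K then c m else 0)"
proof -
  have "fourier_coeff (\<lambda>z. \<Sum>k\<in>K. c k * z powi k) m
      = circle_integral (\<lambda>z. \<Sum>k\<in>K. c k * z powi (k - m))"
    unfolding fourier_coeff_def
  proof (rule circle_integral_cong)
    fix z :: complex assume "z \<in> circle"
    then have "z \<noteq> 0" by auto
    then show "(\<Sum>k\<in>K. c k * z powi k) * z powi - m = (\<Sum>k\<in>K. c k * z powi (k - m))"
      by (auto simp: sum_distrib_right mult.assoc power_int_add[symmetric] intro!: sum.cong)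
  qed
  also have "\<dots> = (\<Sum>k\<in>K. c k * circle_integral (\<lambda>z. z powi (k - m)))"
    using assms
    by (subst circle_integral_sum) (auto simp: circle_integral_cmult intro!: continuous_intros)
  also have "\<dots> = (\<Sum>k\<in>K. if k = m then c m else 0)"
    by (auto simp: circle_integral_powi intro!: sum.cong)
  finally show ?thesis
    using assms by simp
qed

text \<open>An element of the closure differs from a Laurent polynomial by a function of finite norm, and a Laurent
polynomial has only finitely many Fourier coefficients.\<close>

lemma H_theta_finite_norm:
  assumes "0 < \<theta>" "f \<in> H_theta \<theta>"
  shows "finite_norm_theta \<theta> f"
proof -
  obtain p where p: "p \<in> laurent_polynomials" "finite_norm_theta \<theta> (\<lambda>z. f z - p z)"
    using assms(2) unfolding H_theta_def by (auto intro: zero_less_one)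
  then obtain K c where K: "finite K" and p_eq: "p = (\<lambda>z. \<Sum>k\<in>K. c k * z powi (k::int))"
    by (auto simp: laurent_polynomials_def)
  have contf: "continuous_on circle f"
    using assms(2) by (simp add: H_theta_def)
  have contp: "continuous_on circle p"
    unfolding p_eq by (intro continuous_intros) auto
  have coeff: "fourier_coeff f k = fourier_coeff (\<lambda>z. f z - p z) k + fourier_coeff p k" for k
    unfolding fourier_coeff_def
    by (subst circle_integral_add[symmetric])
       (auto simp: algebra_simps intro!: continuous_on_mult continuous_on_diff contf contp
          continuous_on_circle_powi continuous_on_id)
  define w where "w k = \<theta> powi (- 2 * \<bar>k\<bar>)" for k
  have w: "w k \<ge> 0" for k
    using assms(1) by (simp add: w_def)
  have "(\<lambda>k. 2 * ((cmod (fourier_coeff (\<lambda>z. f z - p z) k))\<^sup>2 * w k)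
      + 2 * ((cmod (fourier_coeff p k))\<^sup>2 * w k)) summable_on UNIV"
  proof (intro summable_on_add summable_on_cmult_right)
    show "(\<lambda>k. (cmod (fourier_coeff (\<lambda>z. f z - p z) k))\<^sup>2 * w k) summable_on UNIV"
      using p(2) by (simp add: finite_norm_theta_def w_def)
    show "(\<lambda>k. (cmod (fourier_coeff p k))\<^sup>2 * w k) summable_on UNIV"
      by (rule finite_nonzero_values_imp_summable_on, rule finite_subset[OF _ K])
         (auto simp: p_eq fourier_coeff_laurent_polynomial K split: if_splits)
  qed
  then have "(\<lambda>k. (cmod (fourier_coeff f k))\<^sup>2 * w k) summable_on UNIV"
  proof (rule summable_on_comparison_test)
    fix k
    define x where "x = fourier_coeff (\<lambda>z. f z - p z) k"
    define y where "y = fourier_coeff p k"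
    have "(cmod (x + y))\<^sup>2 \<le> (cmod x + cmod y)\<^sup>2"
      by (intro power_mono norm_triangle_ineq) auto
    also have "\<dots> \<le> 2 * (cmod x)\<^sup>2 + 2 * (cmod y)\<^sup>2"
      using zero_le_power2[of "cmod x - cmod y"] by (simp add: power2_eq_square algebra_simps)
    finally have "(cmod (x + y))\<^sup>2 * w k \<le> (2 * (cmod x)\<^sup>2 + 2 * (cmod y)\<^sup>2) * w k"
      by (intro mult_right_mono w)
    then show "(cmod (fourier_coeff f k))\<^sup>2 * w k
        \<le> 2 * ((cmod (fourier_coeff (\<lambda>z. f z - p z) k))\<^sup>2 * w k)
          + 2 * ((cmod (fourier_coeff p k))\<^sup>2 * w k)"
      unfolding coeff x_def y_def by (simp add: algebra_simps)
  qed (simp add: w)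
  then show ?thesis
    by (simp add: finite_norm_theta_def w_def)
qed

lemma cmod_fourier_coeff_le_norm_theta:
  assumes "0 < \<theta>" "finite_norm_theta \<theta> f"
  shows "cmod (fourier_coeff f k) \<le> norm_theta \<theta> f * \<theta> ^ nat \<bar>k\<bar>"
proof -
  define s where "s k = (cmod (fourier_coeff f k))\<^sup>2 * \<theta> powi (- 2 * \<bar>k\<bar>)" for k
  have "sum s {k} \<le> infsum s UNIV"
    using assms by (intro finite_sum_le_infsum) (auto simp: s_def[abs_def] finite_norm_theta_def)
  then have "sqrt (s k) \<le> norm_theta \<theta> f"
    by (simp add: norm_theta_def s_def[abs_def])
  moreover have "\<theta> powi (- 2 * \<bar>k\<bar>) = (inverse (\<theta> ^ nat \<bar>k\<bar>))\<^sup>2"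
  proof -
    have "- 2 * \<bar>k\<bar> = - int (nat \<bar>k\<bar> * 2)" by simp
    then show ?thesis
      by (simp only: power_int_minus power_int_of_nat power_mult power_inverse)
  qed
  ultimately have "cmod (fourier_coeff f k) * inverse (\<theta> ^ nat \<bar>k\<bar>) \<le> norm_theta \<theta> f"
    using assms(1) by (simp add: s_def real_sqrt_mult)
  then show ?thesis
    using assms(1) by (simp add: field_simps)
qed

lemma norm_theta_nonneg: "norm_theta \<theta> f \<ge> 0" if "0 < \<theta>"
  using that unfolding norm_theta_def by (intro real_sqrt_ge_zero infsum_nonneg) auto

text \<open>The series on the left is a continuous function with the same Fourier coefficients as \<open>f\<close>, so
uniqueness of the coefficients identifies the two.\<close>

lemma fourier_expansion:
  assumes contf: "continuous_on circle f"
    and summable: "(\<lambda>k. cmod (fourier_coeff f k)) summable_on UNIV"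
    and z: "z \<in> circle"
  shows "(\<Sum>\<^sub>\<infinity>k. fourier_coeff f k * z powi k) = f z"
proof -
  define F where "F z = (\<Sum>\<^sub>\<infinity>k. fourier_coeff f k * z powi k)" for z
  have contF: "continuous_on circle F"
    unfolding F_def[abs_def]
    by (rule circle_integral_has_sum(1)[OF _ _ summable])
       (auto intro!: continuous_intros simp: norm_mult norm_power_int)
  have "fourier_coeff F m = fourier_coeff f m" for m
  proof -
    have eq: "fourier_coeff f k * (w powi k * w powi - m) = fourier_coeff f k * w powi (k - m)"
      if "w \<in> circle" for k w
    proof -
      have "w \<noteq> 0" using that by auto
      then show ?thesis by (simp add: power_int_add[symmetric])
    qed
    have "((\<lambda>k. circle_integral (\<lambda>w. fourier_coeff f k * (w powi k * w powi - m))) has_sum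
        circle_integral (\<lambda>w. \<Sum>\<^sub>\<infinity>k. fourier_coeff f k * (w powi k * w powi - m))) UNIV"
      by (rule circle_integral_has_sum(2)[OF _ _ summable])
         (auto intro!: continuous_intros simp: norm_mult norm_power_int)
    moreover have "circle_integral (\<lambda>w. fourier_coeff f k * (w powi k * w powi - m))
        = (if k = m then fourier_coeff f m else 0)" for k
    proof -
      have "circle_integral (\<lambda>w. fourier_coeff f k * (w powi k * w powi - m))
          = circle_integral (\<lambda>w. fourier_coeff f k * w powi (k - m))"
        by (intro circle_integral_cong eq)
      then show ?thesis
        unfolding circle_integral_cmult circle_integral_powi by auto
    qed
    moreover have "((\<lambda>k. if k = m then fourier_coeff f m else 0) has_sum fourier_coeff f m) UNIV"
      by (rule has_sum_finite_neutralI[of "{m}"]) auto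
    ultimately have "circle_integral (\<lambda>w. \<Sum>\<^sub>\<infinity>k. fourier_coeff f k * (w powi k * w powi - m))
        = fourier_coeff f m"
      by (simp add: has_sum_unique)
    then show ?thesis
      by (simp add: fourier_coeff_def[of F] F_def mult.assoc[symmetric] infsum_cmult_left')
  qed
  moreover have "fourier_coeff (\<lambda>w. f w - F w) m = fourier_coeff f m - fourier_coeff F m" for m
    unfolding fourier_coeff_def left_diff_distrib
    by (intro circle_integral_diff continuous_on_mult continuous_on_circle_powi continuous_on_id
        contf contF)
  ultimately have "null_fourier (\<lambda>w. f w - F w)"
    using contf contF by (simp add: null_fourier_def continuous_on_diff)
  from null_fourier_imp_zero[OF this z] show ?thesis
    by (simp add: F_def)
qed

lemma circle_integral_compose_has_sum:
  assumes contf: "continuous_on circle f"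
    and summable: "(\<lambda>k. cmod (fourier_coeff f k)) summable_on UNIV"
    and contu: "continuous_on circle u" and u: "\<And>z. z \<in> circle \<Longrightarrow> u z \<in> circle"
    and contw: "continuous_on circle w"
  shows "((\<lambda>k. fourier_coeff f k * circle_integral (\<lambda>z. u z powi k * w z)) has_sum
           circle_integral (\<lambda>z. f (u z) * w z)) UNIV"
proof -
  have "bounded (w ` circle)"
    using contw by (intro compact_imp_bounded compact_continuous_image) auto
  then obtain W where W: "\<And>z. z \<in> circle \<Longrightarrow> cmod (w z) \<le> W"
    unfolding bounded_pos by blast
  have "((\<lambda>k. circle_integral (\<lambda>z. fourier_coeff f k * (u z powi k * w z))) has_sum
      circle_integral (\<lambda>z. \<Sum>\<^sub>\<infinity>k. fourier_coeff f k * (u z powi k * w z))) UNIV"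
  proof (rule circle_integral_has_sum(2))
    show "(\<lambda>k. cmod (fourier_coeff f k) * W) summable_on UNIV"
      by (intro summable_on_cmult_left summable)
    fix k z assume "z \<in> circle"
    then show "cmod (fourier_coeff f k * (u z powi k * w z)) \<le> cmod (fourier_coeff f k) * W"
      using u[of z] W[of z] by (auto simp: norm_mult norm_power_int intro!: mult_left_mono)
  next
    fix k
    show "continuous_on circle (\<lambda>z. fourier_coeff f k * (u z powi k * w z))"
      using u by (intro continuous_on_mult continuous_on_const continuous_on_circle_powi contu contw)
  qed
  moreover have "circle_integral (\<lambda>z. \<Sum>\<^sub>\<infinity>k. fourier_coeff f k * (u z powi k * w z))
      = circle_integral (\<lambda>z. f (u z) * w z)"
  proof (rule circle_integral_cong)
    fix z assume "z \<in> circle"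
    then show "(\<Sum>\<^sub>\<infinity>k. fourier_coeff f k * (u z powi k * w z)) = f (u z) * w z"
      using fourier_expansion[OF contf summable u]
      by (simp add: mult.assoc[symmetric] infsum_cmult_left')
  qed
  ultimately show ?thesis
    by (simp add: circle_integral_cmult)
qed

text \<open>This turns bounds for the moments of \<open>u\<close> against \<open>w\<close> into a bound for the correlation of \<open>f \<circ> u\<close> and
\<open>w\<close>. The term \<open>k = 0\<close> of the expansion of \<open>f\<close> is the product of means that a correlation subtracts.\<close>

lemma circle_integral_compose_bound:
  fixes t :: real
  assumes contf: "continuous_on circle f"
    and summable: "(\<lambda>k. cmod (fourier_coeff f k)) summable_on UNIV"
    and contu: "continuous_on circle u" and u: "\<And>z. z \<in> circle \<Longrightarrow> u z \<in> circle"
    and contw: "continuous_on circle w"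
    and t: "0 \<le> t" "t < 1" and "0 \<le> B"
    and B: "\<And>k. k \<noteq> 0 \<Longrightarrow>
      cmod (fourier_coeff f k) * cmod (circle_integral (\<lambda>z. u z powi k * w z)) \<le> B * t ^ nat \<bar>k\<bar>"
  shows "cmod (circle_integral (\<lambda>z. f (u z) * w z) - fourier_coeff f 0 * circle_integral w)
           \<le> B * (\<Sum>\<^sub>\<infinity>k::int. t ^ nat \<bar>k\<bar>)"
proof -
  define a where "a k = fourier_coeff f k * circle_integral (\<lambda>z. u z powi k * w z)" for k
  have "(a has_sum circle_integral (\<lambda>z. f (u z) * w z)) UNIV"
    unfolding a_def[abs_def]
    by (rule circle_integral_compose_has_sum) (use assms in auto)
  moreover have "((\<lambda>k. if k = 0 then - a 0 else 0) has_sum - a 0) UNIV"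
    by (rule has_sum_finite_neutralI[of "{0}"]) auto
  ultimately have "((\<lambda>k. a k + (if k = 0 then - a 0 else 0)) has_sum
      circle_integral (\<lambda>z. f (u z) * w z) + - a 0) UNIV"
    by (rule has_sum_add)
  moreover have "((\<lambda>k::int. B * t ^ nat \<bar>k\<bar>) has_sum B * (\<Sum>\<^sub>\<infinity>k::int. t ^ nat \<bar>k\<bar>)) UNIV"
    using summable_on_geometric_int[OF t] by (intro has_sum_cmult_right) simp
  ultimately have "cmod (circle_integral (\<lambda>z. f (u z) * w z) + - a 0)
      \<le> B * (\<Sum>\<^sub>\<infinity>k::int. t ^ nat \<bar>k\<bar>)"
    by (rule norm_infsum_le) (use B t \<open>0 \<le> B\<close> in \<open>auto simp: a_def norm_mult\<close>)
  then show ?thesis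
    by (simp add: a_def)
qed

section \<open>Decay of correlations for maps of the disc that fix 0\<close>

text \<open>What the dynamics uses of a finite Blaschke product: analyticity across the boundary of the disc,
the maximum principle, and modulus 1 on the boundary. Asking for an open neighbourhood of the closed
disc keeps the class easy to compose with maps of the closed disc into itself.\<close>

definition inner_factor :: "(complex \<Rightarrow> complex) \<Rightarrow> bool" where
  "inner_factor b \<longleftrightarrow>
     (\<exists>U. open U \<and> cball 0 1 \<subseteq> U \<and> b holomorphic_on U) \<and>
     (\<forall>z\<in>cball 0 1. cmod (b z) \<le> 1) \<and> (\<forall>z\<in>circle. cmod (b z) = 1)"

text \<open>If \<open>\<phi>\<close> vanishes to order at least \<open>m\<close> at 0, its \<open>n\<close>-th iterate vanishes to order at least \<open>m ^ n\<close>. For \<open>m = 1\<close> the cofactor at 0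
is the multiplier of the iterate at the fixed point 0.\<close>

lemma iterate_zero_order:
  assumes b: "inner_factor b" and m: "m \<ge> 1" and \<phi>: "\<And>z. \<phi> z = z ^ m * b z"
  obtains G where "continuous_on (cball 0 1) G" "G holomorphic_on ball 0 1"
    "\<And>z. z \<in> cball 0 1 \<Longrightarrow> (\<phi> ^^ n) z = z ^ (m ^ n) * G z"
    "\<And>z. z \<in> cball 0 1 \<Longrightarrow> (\<phi> ^^ n) z \<in> cball 0 1"
    "m = 1 \<Longrightarrow> G 0 = b 0 ^ n"
proof -
  have "\<exists>G. continuous_on (cball 0 1) G \<and> G holomorphic_on ball 0 1 \<and>
    (\<forall>z\<in>cball 0 1. (\<phi> ^^ n) z = z ^ (m ^ n) * G z \<and> (\<phi> ^^ n) z \<in> cball 0 1) \<and>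
    (m = 1 \<longrightarrow> G 0 = b 0 ^ n)"
  proof (induction n)
    case 0
    show ?case by (intro exI[of _ "\<lambda>_. 1"]) auto
  next
    case (Suc n)
    then obtain G where contG: "continuous_on (cball 0 1) G" and holG: "G holomorphic_on ball 0 1"
      and it: "\<And>z. z \<in> cball 0 1 \<Longrightarrow> (\<phi> ^^ n) z = z ^ (m ^ n) * G z"
      and disc: "\<And>z. z \<in> cball 0 1 \<Longrightarrow> (\<phi> ^^ n) z \<in> cball 0 1"
      and G0: "m = 1 \<Longrightarrow> G 0 = b 0 ^ n"
      by blast
    obtain U where U: "open U" "cball 0 1 \<subseteq> U" and holb: "b holomorphic_on U"
      using b unfolding inner_factor_def by blast
    define P where "P z = z ^ (m ^ n) * G z" for z
    have contP: "continuous_on (cball 0 1) P" and holP: "P holomorphic_on ball 0 1"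
      unfolding P_def by (intro continuous_intros holomorphic_intros contG holG)+
    have P: "P z \<in> cball 0 1" if "z \<in> cball 0 1" for z
      using it[OF that] disc[OF that] by (simp add: P_def)
    have contbP: "continuous_on (cball 0 1) (\<lambda>z. b (P z))"
      by (rule continuous_on_compose2[OF holomorphic_on_imp_continuous_on[OF holb] contP])
         (use P U in blast)
    have "(b \<circ> P) holomorphic_on ball 0 1"
      by (rule holomorphic_on_compose_gen[OF holP holb]) (use P U in force)
    then have holbP: "(\<lambda>z. b (P z)) holomorphic_on ball 0 1"
      by (simp add: o_def)
    show ?case
    proof (intro exI[of _ "\<lambda>z. G z ^ m * b (P z)"] conjI ballI impI)
      show "continuous_on (cball 0 1) (\<lambda>z. G z ^ m * b (P z))"
        by (intro continuous_intros contG contbP)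
      show "(\<lambda>z. G z ^ m * b (P z)) holomorphic_on ball 0 1"
        by (intro holomorphic_intros holG holbP)
      fix z :: complex assume z: "z \<in> cball 0 1"
      have "(\<phi> ^^ Suc n) z = P z ^ m * b (P z)"
        by (simp add: \<phi> it[OF z] P_def)
      then show "(\<phi> ^^ Suc n) z = z ^ (m ^ Suc n) * (G z ^ m * b (P z))"
        by (simp add: P_def power_mult_distrib power_mult[symmetric] mult.commute)
      have "cmod (P z) \<le> 1" "cmod (b (P z)) \<le> 1"
        using P[OF z] b unfolding inner_factor_def by auto
      then have "cmod (P z) ^ m * cmod (b (P z)) \<le> 1"
        by (intro mult_le_one power_le_one) auto
      then show "(\<phi> ^^ Suc n) z \<in> cball 0 1"
        unfolding \<open>(\<phi> ^^ Suc n) z = P z ^ m * b (P z)\<close> by (simp add: norm_mult norm_power)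
    next
      assume "m = 1"
      then show "G 0 ^ m * b (P 0) = b 0 ^ Suc n"
        by (simp add: G0 P_def)
    qed
  qed
  then show ?thesis
    using that by blast
qed

lemma iterate_circle:
  assumes b: "inner_factor b" and \<phi>: "\<And>z. \<phi> z = z ^ m * b z" and "z \<in> circle"
  shows "(\<phi> ^^ n) z \<in> circle"
  using assms(3)
proof (induction n)
  case (Suc n)
  then show ?case
    using b by (auto simp: inner_factor_def \<phi> norm_mult norm_power)
qed auto

lemma iterate_continuous:
  assumes b: "inner_factor b" and m: "m \<ge> 1" and \<phi>: "\<And>z. \<phi> z = z ^ m * b z"
  shows "continuous_on circle (\<phi> ^^ n)"
proof -
  obtain G where G: "continuous_on (cball 0 1) G"
    "\<And>z. z \<in> cball 0 1 \<Longrightarrow> (\<phi> ^^ n) z = z ^ (m ^ n) * G z"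
    using iterate_zero_order[OF b m \<phi>] by metis
  have "continuous_on (cball 0 1) (\<lambda>z. z ^ (m ^ n) * G z)"
    by (intro continuous_intros G)
  then have "continuous_on (cball 0 1) (\<phi> ^^ n)"
    using G(2) by (metis (no_types, lifting) continuous_on_cong)
  then show ?thesis
    by (rule continuous_on_subset) auto
qed

text \<open>The integrand extends to the disc as an analytic function that vanishes at 0, because the zero of
order \<open>k * m ^ n\<close> outweighs a pole of \<open>z powi (- j)\<close>. The mean value property then gives 0.\<close>

lemma iterate_moment_zero:
  assumes b: "inner_factor b" and m: "m \<ge> 1" and \<phi>: "\<And>z. \<phi> z = z ^ m * b z"
    and j: "j < int (k * m ^ n)"
  shows "circle_integral (\<lambda>z. (\<phi> ^^ n) z ^ k * z powi (- j)) = 0"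
proof -
  obtain G where contG: "continuous_on (cball 0 1) G" and holG: "G holomorphic_on ball 0 1"
    and it: "\<And>z. z \<in> cball 0 1 \<Longrightarrow> (\<phi> ^^ n) z = z ^ (m ^ n) * G z"
    using iterate_zero_order[OF b m \<phi>] by metis
  define e where "e = nat (int (k * m ^ n) - j)"
  have "circle_integral (\<lambda>z. (\<phi> ^^ n) z ^ k * z powi (- j))
      = circle_integral (\<lambda>z. z ^ e * G z ^ k)"
  proof (rule circle_integral_cong)
    fix z :: complex assume z: "z \<in> circle"
    then have "z \<noteq> 0" by auto
    have "z ^ (k * m ^ n) * z powi (- j) = z powi (int (k * m ^ n) + - j)"
      by (simp only: power_int_add[OF disjI1[OF \<open>z \<noteq> 0\<close>]] power_int_of_nat)
    also have "\<dots> = z ^ e"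
      using j by (simp add: e_def power_int_def)
    finally have "z ^ (k * m ^ n) * z powi (- j) = z ^ e" .
    moreover have "(\<phi> ^^ n) z ^ k = z ^ (k * m ^ n) * G z ^ k"
      using z by (simp add: it power_mult_distrib power_mult[symmetric] mult.commute)
    ultimately show "(\<phi> ^^ n) z ^ k * z powi (- j) = z ^ e * G z ^ k"
      by (metis mult.assoc mult.commute)
  qed
  also have "\<dots> = 0 ^ e * G 0 ^ k"
    by (intro circle_integral_mean_value continuous_intros holomorphic_intros contG holG)
  finally show ?thesis
    using j by (simp add: e_def)
qed

text \<open>The previous lemma for negative exponents \<open>k\<close> and \<open>j\<close> as well: complex conjugation on the circle exchanges
\<open>k\<close> and \<open>- k\<close>.\<close>

lemma iterate_correlation_zero:
  assumes b: "inner_factor b" and m: "m \<ge> 1" and \<phi>: "\<And>z. \<phi> z = z ^ m * b z"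
    and "k \<noteq> 0" and j: "\<bar>j\<bar> < int (m ^ n)"
  shows "circle_integral (\<lambda>z. z powi j * cnj ((\<phi> ^^ n) z powi k)) = 0"
proof -
  define i where "i = nat \<bar>k\<bar>"
  have "int (m ^ n) \<le> int (i * m ^ n)"
    using \<open>k \<noteq> 0\<close> mult_right_mono[of 1 "\<bar>k\<bar>" "int (m ^ n)"] by (simp add: i_def)
  then have j': "j < int (i * m ^ n)" "- j < int (i * m ^ n)"
    using j by linarith+
  note circ = iterate_circle[OF b \<phi>]
  show ?thesis
  proof (cases "k > 0")
    case True
    have "circle_integral (\<lambda>z. z powi j * cnj ((\<phi> ^^ n) z powi k))
        = circle_integral (\<lambda>z. cnj ((\<phi> ^^ n) z ^ i * z powi - j))"
    proof (rule circle_integral_cong)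
      fix z :: complex assume "z \<in> circle"
      then have "cnj z powi - j = z powi j"
        using cnj_powi_circle[of z "- j"] by simp
      moreover have "w powi k = w ^ i" for w :: complex
        using True by (simp add: i_def power_int_def)
      ultimately show "z powi j * cnj ((\<phi> ^^ n) z powi k) = cnj ((\<phi> ^^ n) z ^ i * z powi - j)"
        by (simp add: mult.commute)
    qed
    then show ?thesis
      using iterate_moment_zero[OF b m \<phi> j'(1)] by (simp only: circle_integral_cnj complex_cnj_zero)
  next
    case False
    have "circle_integral (\<lambda>z. z powi j * cnj ((\<phi> ^^ n) z powi k))
        = circle_integral (\<lambda>z. (\<phi> ^^ n) z ^ i * z powi - (- j))"
    proof (rule circle_integral_cong)
      fix z :: complex assume "z \<in> circle"
      then have "cnj ((\<phi> ^^ n) z powi k) = (\<phi> ^^ n) z powi (- k)"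
        using cnj_powi_circle[OF circ] by simp
      also have "\<dots> = (\<phi> ^^ n) z ^ i"
        using False by (simp add: i_def power_int_def)
      finally show "z powi j * cnj ((\<phi> ^^ n) z powi k) = (\<phi> ^^ n) z ^ i * z powi - (- j)"
        by simp
    qed
    then show ?thesis
      using iterate_moment_zero[OF b m \<phi> j'(2)] by simp
  qed
qed

text \<open>A frequency \<open>k \<noteq> 0\<close> of \<open>f \<circ> \<phi>\<^sup>n\<close> meets only frequencies \<open>j\<close> of \<open>g\<close> with \<open>\<bar>j\<bar> \<ge> m ^ n\<close>, and there the
coefficients of \<open>g\<close> are of size \<open>\<theta> ^ (m ^ n)\<close>. With \<open>\<theta> = 1/4\<close> this smallness can be split evenly: one factor
\<open>(1/2) ^ \<bar>j\<bar>\<close> is estimated by \<open>(1/2) ^ (m ^ n)\<close>, the other is left to sum over \<open>j\<close>.\<close>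

lemma double_exp_mixing_critical_fixed_point:
  assumes b: "inner_factor b" and m: "m \<ge> 2" and \<phi>: "\<And>z. \<phi> z = z ^ m * b z"
  shows "double_exp_mixing \<phi>"
proof -
  define T where "T = (\<Sum>\<^sub>\<infinity>k::int. (1/2 :: real) ^ nat \<bar>k\<bar>)"
  have "sum (\<lambda>k::int. (1/2 :: real) ^ nat \<bar>k\<bar>) {0} \<le> T"
    unfolding T_def by (intro finite_sum_le_infsum summable_on_geometric_int) auto
  then have T: "T \<ge> 1"
    by simp
  have m1: "m \<ge> 1" using m by simp
  have "cmod (circle_integral (\<lambda>z. f ((\<phi> ^^ n) z) * cnj (g z))
          - circle_integral f * circle_integral (\<lambda>z. cnj (g z)))
      \<le> T\<^sup>2 * exp (- ln 2 * exp (ln (real m) * real n)) * norm_theta (1/4) f * norm_theta (1/4) g"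
    if f: "f \<in> H_theta (1/4)" and g: "g \<in> H_theta (1/4)" for f g n
  proof -
    define u where "u = \<phi> ^^ n"
    define q where "q = (1/2 :: real) ^ (m ^ n)"
    have quarter: "(1/4 :: real) ^ i = (1/2) ^ i * (1/2) ^ i" for i
      by (simp add: power_mult_distrib[symmetric])
    have q: "q = exp (- ln 2 * exp (ln (real m) * real n))"
    proof -
      have "exp (ln (real m) * real n) = real (m ^ n)"
        using m by (simp add: exp_of_nat2_mult)
      moreover have "exp (- ln 2 * real (m ^ n)) = (1/2) ^ (m ^ n)"
        by (simp add: exp_of_nat2_mult exp_minus power_one_over inverse_eq_divide del: of_nat_power)
      ultimately show ?thesis
        by (simp add: q_def)
    qed
    have u: "continuous_on circle u" "\<And>z. z \<in> circle \<Longrightarrow> u z \<in> circle"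
      unfolding u_def using iterate_continuous[OF b m1 \<phi>] iterate_circle[OF b \<phi>] by auto
    have observable: "continuous_on circle h"
      "\<And>k. cmod (fourier_coeff h k) \<le> norm_theta (1/4) h * (1/4) ^ nat \<bar>k\<bar>"
      "(\<lambda>k. cmod (fourier_coeff h k)) summable_on UNIV"
      if "h \<in> H_theta (1/4)" for h
    proof -
      show "continuous_on circle h"
        using that by (simp add: H_theta_def)
      show bd: "cmod (fourier_coeff h k) \<le> norm_theta (1/4) h * (1/4) ^ nat \<bar>k\<bar>" for k
        by (intro cmod_fourier_coeff_le_norm_theta H_theta_finite_norm that) auto
      show "(\<lambda>k. cmod (fourier_coeff h k)) summable_on UNIV"
        by (rule summable_on_comparison_test[OF summable_on_cmult_right[OF summable_on_geometric_int[of "1/4"]]])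
           (use bd in auto)
    qed
    have contg: "continuous_on circle (\<lambda>z. cnj (g z))"
      using observable(1)[OF g] by (rule continuous_on_cnj)
    have contuk: "continuous_on circle (\<lambda>z. u z powi k)" for k
      by (intro continuous_on_circle_powi u)
    have moment: "cmod (circle_integral (\<lambda>z. u z powi k * cnj (g z))) \<le> norm_theta (1/4) g * q * T"
      if "k \<noteq> 0" for k
    proof -
      \<comment> \<open>The roles are exchanged: now \<open>g\<close> is expanded, and the iterate is the fixed factor.\<close>
      define w where "w = (\<lambda>z. cnj (u z powi k))"
      have contw: "continuous_on circle w"
        unfolding w_def by (intro continuous_on_cnj contuk)
      have w0: "circle_integral w = 0"
        using iterate_correlation_zero[OF b m1 \<phi> that, of 0 n] m by (simp add: w_def u_def)
      have "cmod (fourier_coeff g j) * cmod (circle_integral (\<lambda>z. z powi j * w z))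
          \<le> norm_theta (1/4) g * q * (1/2) ^ nat \<bar>j\<bar>" for j
      proof (cases "\<bar>j\<bar> < int (m ^ n)")
        case True
        then show ?thesis
          using iterate_correlation_zero[OF b m1 \<phi> that True] norm_theta_nonneg[of "1/4" g]
          by (simp add: w_def u_def q_def)
      next
        case False
        have "cmod (circle_integral (\<lambda>z. z powi j * w z)) \<le> 1"
          using u(2) by (intro cmod_circle_integral_le continuous_on_mult contw
              continuous_on_circle_powi continuous_on_id) (auto simp: w_def norm_mult norm_power_int)
        moreover have "(1/2 :: real) ^ nat \<bar>j\<bar> \<le> q"
          unfolding q_def using False by (intro power_decreasing) (auto simp: le_nat_iff)
        then have "(1/4 :: real) ^ nat \<bar>j\<bar> \<le> q * (1/2) ^ nat \<bar>j\<bar>"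
          unfolding quarter by (intro mult_right_mono) auto
        then have "norm_theta (1/4) g * (1/4) ^ nat \<bar>j\<bar> \<le> norm_theta (1/4) g * (q * (1/2) ^ nat \<bar>j\<bar>)"
          by (intro mult_left_mono norm_theta_nonneg) auto
        then have "cmod (fourier_coeff g j) \<le> norm_theta (1/4) g * q * (1/2) ^ nat \<bar>j\<bar>"
          using observable(2)[OF g, of j] by (simp add: mult.assoc)
        ultimately show ?thesis
          by (meson mult_left_le norm_ge_zero order_trans)
      qed
      then have "cmod (circle_integral (\<lambda>z. g z * w z) - fourier_coeff g 0 * circle_integral w)
          \<le> norm_theta (1/4) g * q * T"
        unfolding T_def using observable(1,3)[OF g] contw norm_theta_nonneg[of "1/4" g]
        by (intro circle_integral_compose_bound[where u = "\<lambda>z. z"]) (auto simp: q_def)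
      moreover have "circle_integral (\<lambda>z. u z powi k * cnj (g z)) = cnj (circle_integral (\<lambda>z. g z * w z))"
        unfolding circle_integral_cnj[symmetric] by (simp add: w_def mult.commute)
      ultimately show ?thesis
        by (simp add: w0)
    qed
    have "cmod (circle_integral (\<lambda>z. f (u z) * cnj (g z)) - fourier_coeff f 0 * circle_integral (\<lambda>z. cnj (g z)))
        \<le> (norm_theta (1/4) f * (norm_theta (1/4) g * q * T)) * T"
      unfolding T_def
    proof (rule circle_integral_compose_bound[OF observable(1,3)[OF f] u contg])
      show "0 \<le> norm_theta (1/4) f * (norm_theta (1/4) g * q * (\<Sum>\<^sub>\<infinity>k::int. (1/2) ^ nat \<bar>k\<bar>))"
        using norm_theta_nonneg[of "1/4"] T by (auto simp: q_def T_def)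
      fix k :: int assume "k \<noteq> 0"
      have "(1/4 :: real) ^ nat \<bar>k\<bar> \<le> (1/2) ^ nat \<bar>k\<bar>"
        by (intro power_mono) auto
      then have "norm_theta (1/4) f * (1/4) ^ nat \<bar>k\<bar> \<le> norm_theta (1/4) f * (1/2) ^ nat \<bar>k\<bar>"
        by (intro mult_left_mono norm_theta_nonneg) auto
      then have "cmod (fourier_coeff f k) \<le> norm_theta (1/4) f * (1/2) ^ nat \<bar>k\<bar>"
        using observable(2)[OF f, of k] by linarith
      then have "cmod (fourier_coeff f k) * cmod (circle_integral (\<lambda>z. u z powi k * cnj (g z)))
          \<le> (norm_theta (1/4) f * (1/2) ^ nat \<bar>k\<bar>) * (norm_theta (1/4) g * q * T)"
        using moment[OF \<open>k \<noteq> 0\<close>] norm_theta_nonneg[of "1/4" f] by (intro mult_mono) auto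
      then show "cmod (fourier_coeff f k) * cmod (circle_integral (\<lambda>z. u z powi k * cnj (g z)))
          \<le> norm_theta (1/4) f * (norm_theta (1/4) g * q * (\<Sum>\<^sub>\<infinity>k::int. (1/2) ^ nat \<bar>k\<bar>)) * (1/2) ^ nat \<bar>k\<bar>"
        by (simp add: T_def mult_ac)
    qed auto
    moreover have "fourier_coeff f 0 = circle_integral f"
      by (simp add: fourier_coeff_def)
    ultimately show ?thesis
      unfolding q[symmetric] u_def[symmetric] by (simp add: power2_eq_square mult_ac)
  qed
  moreover have "ln (real m) > 0" "ln (2::real) > 0"
    using m by auto
  ultimately show ?thesis
    unfolding double_exp_mixing_def using T
    by (intro exI[of _ "1/4"] exI[of _ "ln 2"] exI[of _ "ln (real m)"] exI[of _ "T\<^sup>2"] conjI ballI allI impI) auto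
qed

text \<open>The observable \<open>f = g = z\<close> has correlations \<open>\<integral> \<phi>\<^sup>n(z) / z d\<mu>\<close>, which the mean value property evaluates as
the derivative of \<open>\<phi>\<^sup>n\<close> at the fixed point 0, that is as \<open>b(0)\<^sup>n\<close>. They decay only exponentially, and this
observable lies in every one of the spaces.\<close>

lemma not_double_exp_mixing_noncritical_fixed_point:
  assumes b: "inner_factor b" and \<phi>: "\<And>z. \<phi> z = z * b z" and b0: "b 0 \<noteq> 0"
  shows "\<not> double_exp_mixing \<phi>"
proof
  assume "double_exp_mixing \<phi>"
  then obtain \<theta> \<beta> \<gamma> C :: real where \<theta>: "0 < \<theta>" "\<theta> < 1" and \<beta>: "\<beta> > 0" and \<gamma>: "\<gamma> > 0" and "C > 0"
    and mix: "\<And>f g n. f \<in> H_theta \<theta> \<Longrightarrow> g \<in> H_theta \<theta> \<Longrightarrow> n \<ge> 1 \<Longrightarrow>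
      cmod (circle_integral (\<lambda>z. f ((\<phi> ^^ n) z) * cnj (g z))
        - circle_integral f * circle_integral (\<lambda>z. cnj (g z)))
      \<le> C * exp (- \<beta> * exp (\<gamma> * real n)) * norm_theta \<theta> f * norm_theta \<theta> g"
    unfolding double_exp_mixing_def by blast
  have id_in: "(\<lambda>z. z) \<in> H_theta \<theta>"
  proof -
    have "(\<lambda>z::complex. z) \<in> laurent_polynomials"
      unfolding laurent_polynomials_def
      by (intro CollectI exI[of _ "{1}"] exI[of _ "\<lambda>_. 1"]) auto
    moreover have "fourier_coeff (\<lambda>z. 0) k = 0" for k
      by (simp add: fourier_coeff_def)
    ultimately show ?thesis
      unfolding H_theta_def finite_norm_theta_def norm_theta_def
      by (auto intro!: bexI[of _ "\<lambda>z. z"] continuous_intros)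
  qed
  have id0: "circle_integral (\<lambda>z. z) = 0"
    using circle_integral_powi[of 1] by simp
  have cor: "circle_integral (\<lambda>z. (\<phi> ^^ n) z * cnj z) = b 0 ^ n" for n
  proof -
    obtain G where G: "continuous_on (cball 0 1) G" "G holomorphic_on ball 0 1"
      "\<And>z. z \<in> cball 0 1 \<Longrightarrow> (\<phi> ^^ n) z = z ^ (1 ^ n) * G z" "G 0 = b 0 ^ n"
      using iterate_zero_order[OF b, of 1 \<phi> n] \<phi> by (metis order_refl power_one_right)
    have "circle_integral (\<lambda>z. (\<phi> ^^ n) z * cnj z) = circle_integral G"
    proof (rule circle_integral_cong)
      fix z :: complex assume z: "z \<in> circle"
      then have "z * cnj z = 1"
        by (simp add: complex_norm_square[symmetric])
      then show "(\<phi> ^^ n) z * cnj z = G z"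
        using G(3)[of z] z by (simp add: mult_ac)
    qed
    then show ?thesis
      using circle_integral_mean_value[OF G(1,2)] G(4) by simp
  qed
  define r where "r = cmod (b 0)"
  define D where "D = C * (norm_theta \<theta> (\<lambda>z. z))\<^sup>2"
  define L where "L = - ln r"
  have "r > 0"
    using b0 by (simp add: r_def)
  \<comment> \<open>\<open>exp (L * n)\<close> is the reciprocal of \<open>r ^ n\<close>, the modulus of the correlation.\<close>
  have bound: "1 \<le> D * (exp (- \<beta> * exp (\<gamma> * real n)) * exp (L * real n))" if "n \<ge> 1" for n
  proof -
    have "r ^ n \<le> D * exp (- \<beta> * exp (\<gamma> * real n))"
      using mix[OF id_in id_in that] unfolding cor id0
      by (simp add: norm_power r_def D_def power2_eq_square mult_ac)
    moreover have "r ^ n * exp (L * real n) = 1"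
    proof -
      have "r ^ n = exp (real n * ln r)"
        using \<open>r > 0\<close> by (simp add: exp_of_nat_mult)
      then show ?thesis
        by (simp add: L_def exp_add[symmetric] mult.commute)
    qed
    ultimately show ?thesis
      by (metis exp_ge_zero mult.assoc mult_right_mono)
  qed
  have "((\<lambda>n. D * (exp (- \<beta> * exp (\<gamma> * real n)) * exp (L * real n))) \<longlongrightarrow> D * 0) sequentially"
    using \<beta> \<gamma> by (intro tendsto_mult tendsto_const) real_asymp
  then have "1 \<le> D * 0"
    by (rule tendsto_lowerbound) (use bound in \<open>auto intro!: eventually_sequentiallyI[of 1]\<close>)
  then show False
    by simp
qed

section \<open>Rigidity of conjugacies to the cube map\<close>

lemma cubic_vieta:
  fixes y1 y2 y3 :: complex
  assumes "y1 \<noteq> y2" "y1 \<noteq> y3" "y2 \<noteq> y3"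
    and "y1 ^ 3 + p * y1\<^sup>2 + q * y1 = x" "y2 ^ 3 + p * y2\<^sup>2 + q * y2 = x"
      "y3 ^ 3 + p * y3\<^sup>2 + q * y3 = x"
  shows "p = - (y1 + y2 + y3)" "q = y1 * y2 + y1 * y3 + y2 * y3" "x = y1 * y2 * y3"
proof -
  have quot: "a\<^sup>2 + a * b + b\<^sup>2 + p * (a + b) + q = 0"
    if "a \<noteq> b" "a ^ 3 + p * a\<^sup>2 + q * a = x" "b ^ 3 + p * b\<^sup>2 + q * b = x" for a b
  proof -
    have "(a - b) * (a\<^sup>2 + a * b + b\<^sup>2 + p * (a + b) + q)
        = (a ^ 3 + p * a\<^sup>2 + q * a) - (b ^ 3 + p * b\<^sup>2 + q * b)"
      by (simp add: power2_eq_square power3_eq_cube algebra_simps)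
    then show ?thesis using that by simp
  qed
  have 12: "y1\<^sup>2 + y1 * y2 + y2\<^sup>2 + p * (y1 + y2) + q = 0"
    and 13: "y1\<^sup>2 + y1 * y3 + y3\<^sup>2 + p * (y1 + y3) + q = 0"
    using quot[OF assms(1,4,5)] quot[OF assms(2,4,6)] by auto
  have "(y2 - y3) * (y1 + y2 + y3 + p) = 0"
    using 12 13 by algebra
  then show p: "p = - (y1 + y2 + y3)"
    using assms(3) minus_unique[of "y1 + y2 + y3" p] by simp
  show q: "q = y1 * y2 + y1 * y3 + y2 * y3"
    using 12 p by algebra
  show "x = y1 * y2 * y3"
    using assms(4) unfolding p q by (simp add: power2_eq_square power3_eq_cube algebra_simps)
qed

lemma lagrange_interpolation_at_zero:
  fixes y1 y2 y3 d0 d1 d2 :: complex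
  assumes "y1 \<noteq> y2" "y1 \<noteq> y3" "y2 \<noteq> y3"
  defines "D \<equiv> \<lambda>y. d0 + d1 * y + d2 * y\<^sup>2"
  shows "D y1 * (y2 * y3) / ((y1 - y2) * (y1 - y3)) + D y2 * (y1 * y3) / ((y2 - y1) * (y2 - y3))
       + D y3 * (y1 * y2) / ((y3 - y1) * (y3 - y2)) = d0"
proof -
  \<comment> \<open>The three fractions are brought to the Vandermonde denominator \<open>E\<close>.\<close>
  define E where "E = (y1 - y2) * (y1 - y3) * (y2 - y3)"
  have nz: "y1 - y2 \<noteq> 0" "y1 - y3 \<noteq> 0" "y2 - y3 \<noteq> 0"
    using assms by auto
  then have "E \<noteq> 0"
    by (simp add: E_def)
  have t1: "D y1 * (y2 * y3) / ((y1 - y2) * (y1 - y3)) = D y1 * (y2 * y3) * (y2 - y3) / E"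
    using nz by (simp add: E_def)
  have t2: "D y2 * (y1 * y3) / ((y2 - y1) * (y2 - y3)) = - (D y2 * (y1 * y3) * (y1 - y3)) / E"
    using nz unfolding E_def by (simp add: divide_simps) (simp add: algebra_simps)
  have t3: "D y3 * (y1 * y2) / ((y3 - y1) * (y3 - y2)) = D y3 * (y1 * y2) * (y1 - y2) / E"
    using nz unfolding E_def by (simp add: divide_simps) (simp add: algebra_simps)
  have "D y1 * (y2 * y3) * (y2 - y3) + - (D y2 * (y1 * y3) * (y1 - y3)) + D y3 * (y1 * y2) * (y1 - y2)
      = d0 * E"
    unfolding D_def E_def by (simp add: power2_eq_square algebra_simps)
  then show ?thesis
    unfolding t1 t2 t3 add_divide_distrib[symmetric] using \<open>E \<noteq> 0\<close> by simp
qed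

lemma circle_derivative_unique:
  assumes "z \<in> circle" "(f has_field_derivative D) (at z within circle)"
    "(f has_field_derivative E) (at z within circle)"
  shows "D = E"
  using circle_deriv_eqI[OF assms(1,2)] circle_deriv_eqI[OF assms(1,3)] by simp

lemma circle_has_cube_roots:
  assumes "x \<in> circle"
  obtains z1 z2 z3 where "z1 \<noteq> z2" "z1 \<noteq> z3" "z2 \<noteq> z3"
    "{z1, z2, z3} \<subseteq> circle" "z1 ^ 3 = x" "z2 ^ 3 = x" "z3 ^ 3 = x"
proof -
  have "card {z. z ^ 3 = x} = 3"
    using assms by (intro card_nth_roots) auto
  then obtain z1 z2 z3 where z: "{z. z ^ 3 = x} = {z1, z2, z3}" "z1 \<noteq> z2" "z2 \<noteq> z3" "z1 \<noteq> z3"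
    unfolding card_3_iff by blast
  have root: "z ^ 3 = x \<and> z \<in> circle" if "z \<in> {z1, z2, z3}" for z
  proof -
    have "z ^ 3 = x"
      using that z(1) by blast
    then have "cmod z ^ 3 = 1"
      using assms by (simp add: norm_power[symmetric])
    then have "cmod z = 1"
      using power_eq_imp_eq_base[of "cmod z" 3 1] by simp
    then show ?thesis
      using \<open>z ^ 3 = x\<close> by simp
  qed
  then show ?thesis
    using that[of z1 z2 z3] z by (meson insertCI subsetI)
qed

text \<open>For a map of the circle into itself, \<open>L(z) = z \<phi>'(z) / \<phi>(z) > 0\<close> is \<open>\<bar>\<phi>'(z)\<bar>\<close>, and the claim is that the
inverse derivatives at the three preimages of a point add up to 1, which is invariance of \<open>\<mu>\<close>. Writing
\<open>\<phi> = N / D\<close>, the preimages are the roots of the monic cubic \<open>N - x * D\<close>, whose constant term gives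
\<open>x = y1 * y2 * y3\<close>. The inverse derivatives then become the terms in the Lagrange interpolation of \<open>D\<close> at
0, and \<open>D(0) = 1\<close>.\<close>

lemma transfer_weights_sum_one:
  fixes y1 y2 y3 x :: complex and L :: "complex \<Rightarrow> real"
  assumes \<phi>: "\<And>z. \<phi> z = (z ^ 3 + n2 * z\<^sup>2 + n1 * z) / (1 + d1 * z + d2 * z\<^sup>2)"
    and D: "\<And>z. z \<in> circle \<Longrightarrow> 1 + d1 * z + d2 * z\<^sup>2 \<noteq> 0"
    and deriv: "\<And>z. z \<in> circle \<Longrightarrow> (\<phi> has_field_derivative \<phi> z * of_real (L z) / z) (at z)"
    and L: "\<And>z. z \<in> circle \<Longrightarrow> L z > 0"
    and y: "y1 \<noteq> y2" "y1 \<noteq> y3" "y2 \<noteq> y3" "y1 \<in> circle" "y2 \<in> circle" "y3 \<in> circle"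
    and x: "\<phi> y1 = x" "\<phi> y2 = x" "\<phi> y3 = x" "x \<noteq> 0"
  shows "1 / L y1 + 1 / L y2 + 1 / L y3 = 1"
proof -
  define Dn where "Dn z = 1 + d1 * z + d2 * z\<^sup>2" for z
  define p where "p = n2 - x * d2"
  define q where "q = n1 - x * d1"
  have root: "z ^ 3 + p * z\<^sup>2 + q * z = x" if "z \<in> circle" "\<phi> z = x" for z
    using that(2) D[OF that(1)] by (simp add: \<phi> p_def q_def field_simps)
  note vieta = cubic_vieta[OF y(1-3) root[OF y(4) x(1)] root[OF y(5) x(2)] root[OF y(6) x(3)]]
  have log_deriv: "x * of_real (L z) / z = (3 * z\<^sup>2 + 2 * p * z + q) / Dn z"
    if z: "z \<in> circle" "\<phi> z = x" for z
  proof -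
    have "((\<lambda>z. (z ^ 3 + n2 * z\<^sup>2 + n1 * z) / (1 + d1 * z + d2 * z\<^sup>2)) has_field_derivative
        ((3 * z\<^sup>2 + n2 * (2 * z) + n1) * Dn z - (z ^ 3 + n2 * z\<^sup>2 + n1 * z) * (d1 + d2 * (2 * z)))
          / (Dn z * Dn z)) (at z)"
      using D[OF z(1)] unfolding Dn_def by (auto intro!: derivative_eq_intros simp: mult_ac)
    then have "\<phi> z * of_real (L z) / z
        = ((3 * z\<^sup>2 + n2 * (2 * z) + n1) * Dn z - (z ^ 3 + n2 * z\<^sup>2 + n1 * z) * (d1 + d2 * (2 * z)))
          / (Dn z * Dn z)"
      using deriv[OF z(1)] \<phi> by (metis (no_types, lifting) DERIV_unique ext)
    also have "z ^ 3 + n2 * z\<^sup>2 + n1 * z = x * Dn z"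
      using z D[OF z(1)] by (simp add: \<phi> Dn_def field_simps)
    also have "(3 * z\<^sup>2 + n2 * (2 * z) + n1) * Dn z - x * Dn z * (d1 + d2 * (2 * z))
        = (3 * z\<^sup>2 + 2 * p * z + q) * Dn z"
      by (simp add: p_def q_def algebra_simps)
    also have "\<dots> / (Dn z * Dn z) = (3 * z\<^sup>2 + 2 * p * z + q) / Dn z"
      using D[OF z(1)] by (simp add: Dn_def)
    finally show ?thesis
      using z(2) by simp
  qed
  have weight: "complex_of_real (1 / L a) = Dn a * (b * c) / ((a - b) * (a - c))"
    if "a \<in> circle" "\<phi> a = x" "a \<noteq> b" "a \<noteq> c"
      "p = - (a + b + c)" "q = a * b + a * c + b * c" "x = a * b * c" for a b c
  proof -
    have "3 * a\<^sup>2 + 2 * p * a + q = (a - b) * (a - c)"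
      unfolding that(5,6) by algebra
    then have "x * of_real (L a) / a = (a - b) * (a - c) / Dn a"
      using log_deriv[OF that(1,2)] by simp
    moreover have "a \<noteq> 0" "Dn a \<noteq> 0" "complex_of_real (L a) \<noteq> 0"
      using that(1) D[OF that(1)] L[OF that(1)] by (auto simp: Dn_def)
    ultimately have "b * c * of_real (L a) * Dn a = (a - b) * (a - c)"
      using that(7) by (simp add: field_simps)
    moreover have "(a - b) * (a - c) \<noteq> 0"
      using that(3,4) by simp
    ultimately have "1 / complex_of_real (L a) = Dn a * (b * c) / ((a - b) * (a - c))"
      using \<open>complex_of_real (L a) \<noteq> 0\<close> by (subst frac_eq_eq) (auto simp: mult_ac)
    then show ?thesis
      by simp
  qed
  have "complex_of_real (1 / L y1 + 1 / L y2 + 1 / L y3)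
      = Dn y1 * (y2 * y3) / ((y1 - y2) * (y1 - y3)) + Dn y2 * (y1 * y3) / ((y2 - y1) * (y2 - y3))
        + Dn y3 * (y1 * y2) / ((y3 - y1) * (y3 - y2))"
    using weight[of y1 y2 y3] weight[of y2 y1 y3] weight[of y3 y1 y2] y x vieta
    by (simp add: add_ac mult_ac)
  also have "\<dots> = 1"
    unfolding Dn_def by (rule lagrange_interpolation_at_zero[OF y(1-3)])
  finally show ?thesis
    using of_real_eq_1_iff by blast
qed

text \<open>A conjugacy \<open>h\<close> satisfies \<open>L(h(z)) * \<bar>h'(z)\<bar> = 3 * \<bar>h'(z ^ 3)\<bar>\<close>. Let \<open>x\<close> minimise \<open>\<bar>h'\<bar>\<close>. At the three cube
roots of \<open>x\<close> this forces \<open>L \<le> 3\<close>, so each of the three inverses is at least 1/3. Their sum is 1, since the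
images of the cube roots are the preimages of \<open>h(x)\<close> under \<open>\<phi>\<close>. Hence \<open>L = 3\<close> at three points.\<close>

lemma not_C1_conjugate_phi0:
  fixes L :: "complex \<Rightarrow> real"
  assumes \<phi>: "\<And>z. \<phi> z = (z ^ 3 + n2 * z\<^sup>2 + n1 * z) / (1 + d1 * z + d2 * z\<^sup>2)"
    and D: "\<And>z. z \<in> circle \<Longrightarrow> 1 + d1 * z + d2 * z\<^sup>2 \<noteq> 0"
    and circ: "\<And>z. z \<in> circle \<Longrightarrow> \<phi> z \<in> circle"
    and deriv: "\<And>z. z \<in> circle \<Longrightarrow> (\<phi> has_field_derivative \<phi> z * of_real (L z) / z) (at z)"
    and L: "\<And>z. z \<in> circle \<Longrightarrow> L z > 0"
    and two: "\<And>y1 y2 y3. \<lbrakk>y1 \<in> circle; y2 \<in> circle; y3 \<in> circle; y1 \<noteq> y2; y1 \<noteq> y3; y2 \<noteq> y3;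
      L y1 = 3; L y2 = 3; L y3 = 3\<rbrakk> \<Longrightarrow> False"
  shows "\<not> C1_conjugate \<phi> phi0"
proof
  assume "C1_conjugate \<phi> phi0"
  then obtain h where bij: "bij_betw h circle circle" and "C1_on_circle h"
    and "C1_on_circle (inv_into circle h)" and conj: "\<And>z. z \<in> circle \<Longrightarrow> \<phi> (h z) = h (z ^ 3)"
    unfolding C1_conjugate_def C1_diffeo_circle_def phi0_def by blast
  then obtain h' g' where conth': "continuous_on circle h'"
    and h': "\<And>z. z \<in> circle \<Longrightarrow> (h has_field_derivative h' z) (at z within circle)"
    and g': "\<And>z. z \<in> circle \<Longrightarrow> (inv_into circle h has_field_derivative g' z) (at z within circle)"
    unfolding C1_on_circle_def by blast
  have h: "h z \<in> circle" if "z \<in> circle" for z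
    using bij that by (auto simp: bij_betw_def)
  have img: "h ` circle = circle"
    using bij by (simp add: bij_betw_def)
  have cube: "z ^ 3 \<in> circle" if "z \<in> circle" for z :: complex
    using that by (simp add: norm_power)
  \<comment> \<open>This allows cancelling \<open>\<bar>h'\<bar>\<close> at the cube roots below.\<close>
  have h'_nz: "h' z \<noteq> 0" if z: "z \<in> circle" for z
  proof -
    have "(inv_into circle h \<circ> h has_field_derivative g' (h z) * h' z) (at z within circle)"
      by (rule DERIV_image_chain) (use g'[OF h[OF z]] h'[OF z] img in auto)
    moreover have "(inv_into circle h \<circ> h has_field_derivative 1) (at z within circle)"
      by (rule has_field_derivative_transform_within[OF DERIV_ident zero_less_one z])
         (use bij in \<open>auto simp: bij_betw_def inv_into_f_f\<close>)
    ultimately have "g' (h z) * h' z = 1"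
      by (rule circle_derivative_unique[OF z])
    then show ?thesis by auto
  qed
  have cocycle: "L (h z) * cmod (h' z) = 3 * cmod (h' (z ^ 3))" if z: "z \<in> circle" for z
  proof -
    have "(\<phi> \<circ> h has_field_derivative \<phi> (h z) * of_real (L (h z)) / h z * h' z) (at z within circle)"
      by (rule DERIV_image_chain[OF has_field_derivative_at_within[OF deriv[OF h[OF z]]] h'[OF z]])
    moreover have "(h \<circ> (\<lambda>z. z ^ 3) has_field_derivative h' (z ^ 3) * (3 * z\<^sup>2)) (at z within circle)"
    proof (rule DERIV_image_chain)
      show "(h has_field_derivative h' (z ^ 3)) (at (z ^ 3) within (\<lambda>z. z ^ 3) ` circle)"
        by (rule DERIV_subset[OF h'[OF cube[OF z]]]) (use cube in auto)
    qed (auto intro!: derivative_eq_intros)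
    then have "(\<phi> \<circ> h has_field_derivative h' (z ^ 3) * (3 * z\<^sup>2)) (at z within circle)"
      by (rule has_field_derivative_transform_within[OF _ zero_less_one z]) (simp add: conj)
    ultimately have "\<phi> (h z) * of_real (L (h z)) / h z * h' z = h' (z ^ 3) * (3 * z\<^sup>2)"
      by (rule circle_derivative_unique[OF z])
    then have "cmod (\<phi> (h z) * of_real (L (h z)) / h z * h' z) = cmod (h' (z ^ 3) * (3 * z\<^sup>2))"
      by (rule arg_cong)
    then show ?thesis
      using z h[OF z] circ[OF h[OF z]] L[OF h[OF z]]
      by (simp add: norm_mult norm_divide norm_power mult.commute)
  qed
  have "\<exists>x\<in>circle. \<forall>z\<in>circle. cmod (h' x) \<le> cmod (h' z)"
  proof (rule continuous_attains_inf)
    show "continuous_on circle (\<lambda>z. cmod (h' z))"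
      by (intro continuous_on_norm conth')
  qed auto
  then obtain x where x: "x \<in> circle" and min: "\<And>z. z \<in> circle \<Longrightarrow> cmod (h' x) \<le> cmod (h' z)"
    by blast
  obtain z1 z2 z3 where z: "z1 \<noteq> z2" "z1 \<noteq> z3" "z2 \<noteq> z3" "{z1, z2, z3} \<subseteq> circle"
    "z1 ^ 3 = x" "z2 ^ 3 = x" "z3 ^ 3 = x"
    using circle_has_cube_roots[OF x] by metis
  have Lle: "1 / L (h z) \<ge> 1 / 3" if "z \<in> circle" "z ^ 3 = x" for z
  proof -
    have "L (h z) * cmod (h' z) \<le> 3 * cmod (h' z)"
      using cocycle[OF that(1)] min[OF that(1)] that(2) by simp
    then have "L (h z) \<le> 3"
      using h'_nz[OF that(1)] by simp
    then show ?thesis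
      using L[OF h[OF that(1)]] by (intro divide_left_mono) auto
  qed
  have inj: "h a \<noteq> h b" if "a \<in> circle" "b \<in> circle" "a \<noteq> b" for a b
    using bij that by (auto simp: bij_betw_def inj_on_def)
  have hx: "h x \<noteq> 0" using h[OF x] by auto
  have sum: "1 / L (h z1) + 1 / L (h z2) + 1 / L (h z3) = 1"
    by (rule transfer_weights_sum_one[OF \<phi> D deriv L, where x = "h x"])
       (use z conj h hx inj in auto)
  have "1 / L (h z1) \<ge> 1 / 3" "1 / L (h z2) \<ge> 1 / 3" "1 / L (h z3) \<ge> 1 / 3"
    using z by (auto intro!: Lle simp del: divide_le_eq_numeral1 le_divide_eq_numeral1)
  with sum have "1 / L (h z1) = 1 / 3" "1 / L (h z2) = 1 / 3" "1 / L (h z3) = 1 / 3"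
    by linarith+
  then show False
    using two[of "h z1" "h z2" "h z3"] z h inj by (auto simp: field_simps)
qed

section \<open>Moebius maps of the disc\<close>

definition mobius :: "complex \<Rightarrow> complex \<Rightarrow> complex" where
  "mobius lam z = (z - lam) / (1 - cnj lam * z)"

text \<open>The Poisson kernel of the disc at the point \<open>lam\<close>, written with \<open>\<bar>1 - cnj lam * z\<bar> = \<bar>z - lam\<bar>\<close> for \<open>\<bar>z\<bar> = 1\<close>.
On the circle it is the logarithmic derivative \<open>z b'(z) / b(z)\<close> of the Moebius map \<open>b\<close>, that is its
angular speed.\<close>

definition poisson :: "complex \<Rightarrow> complex \<Rightarrow> real" where
  "poisson lam z = (1 - (cmod lam)\<^sup>2) / (cmod (1 - cnj lam * z))\<^sup>2"

lemma mobius_denominator_nonzero: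
  assumes "cmod lam < 1" "cmod z \<le> 1"
  shows "1 - cnj lam * z \<noteq> 0"
proof
  assume "1 - cnj lam * z = 0"
  then have "cmod lam * cmod z = 1"
    by (metis complex_mod_cnj eq_iff_diff_eq_0 norm_mult norm_one)
  moreover have "cmod lam * cmod z \<le> cmod lam"
    using assms by (simp add: mult_left_le)
  ultimately show False
    using assms by simp
qed

lemma cmod_mobius_identity:
  "(cmod (1 - cnj lam * z))\<^sup>2 - (cmod (z - lam))\<^sup>2 = (1 - (cmod lam)\<^sup>2) * (1 - (cmod z)\<^sup>2)"
proof -
  have "complex_of_real ((cmod (1 - cnj lam * z))\<^sup>2 - (cmod (z - lam))\<^sup>2)
      = complex_of_real ((1 - (cmod lam)\<^sup>2) * (1 - (cmod z)\<^sup>2))"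
    unfolding of_real_diff of_real_mult complex_norm_square by (simp add: algebra_simps)
  then show ?thesis
    using of_real_eq_iff by blast
qed

lemma cmod_mobius_le:
  assumes "cmod lam < 1" "cmod z \<le> 1"
  shows "cmod (mobius lam z) \<le> 1"
proof -
  have "(1 - (cmod lam)\<^sup>2) * (1 - (cmod z)\<^sup>2) \<ge> 0"
    using assms by (intro mult_nonneg_nonneg) (auto simp: power_le_one_iff)
  then have "(cmod (z - lam))\<^sup>2 \<le> (cmod (1 - cnj lam * z))\<^sup>2"
    using cmod_mobius_identity[of lam z] by linarith
  then have "cmod (z - lam) \<le> cmod (1 - cnj lam * z)"
    by (rule power2_le_imp_le) simp
  then show ?thesis
    using mobius_denominator_nonzero[OF assms] by (simp add: mobius_def norm_divide)
qed

lemma cmod_mobius_circle: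
  assumes "cmod lam < 1" "z \<in> circle"
  shows "cmod (mobius lam z) = 1"
proof -
  have "(cmod (z - lam))\<^sup>2 = (cmod (1 - cnj lam * z))\<^sup>2"
    using cmod_mobius_identity[of lam z] assms by simp
  then have "cmod (z - lam) = cmod (1 - cnj lam * z)"
    by (simp add: power2_eq_iff_nonneg)
  then show ?thesis
    using mobius_denominator_nonzero[of lam z] assms by (simp add: mobius_def norm_divide)
qed

lemma mobius_has_field_derivative:
  assumes "1 - cnj lam * z \<noteq> 0"
  shows "(mobius lam has_field_derivative (1 - of_real ((cmod lam)\<^sup>2)) / (1 - cnj lam * z)\<^sup>2) (at z)"
proof -
  have "((\<lambda>z. (z - lam) / (1 - cnj lam * z)) has_field_derivative
      ((1 - cnj lam * z) + (z - lam) * cnj lam) / ((1 - cnj lam * z) * (1 - cnj lam * z))) (at z)"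
    using assms by (auto intro!: derivative_eq_intros)
  moreover have "(1 - cnj lam * z) + (z - lam) * cnj lam = 1 - of_real ((cmod lam)\<^sup>2)"
    unfolding complex_norm_square by (simp add: algebra_simps)
  ultimately show ?thesis
    by (simp add: mobius_def[abs_def] power2_eq_square)
qed

lemma mobius_derivative_circle:
  assumes "cmod lam < 1" "z \<in> circle"
  shows "(1 - of_real ((cmod lam)\<^sup>2)) / (1 - cnj lam * z)\<^sup>2 = mobius lam z * of_real (poisson lam z) / z"
proof -
  define w where "w = 1 - cnj lam * z"
  have w: "w \<noteq> 0"
    using mobius_denominator_nonzero[of lam z] assms by (auto simp: w_def)
  have "z \<noteq> 0" "z * cnj z = 1"
    using assms by (auto simp: complex_norm_square[symmetric])
  then have "z - lam = z * cnj w"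
    by (simp add: w_def algebra_simps)
  moreover have "complex_of_real (poisson lam z) = (1 - of_real ((cmod lam)\<^sup>2)) / (w * cnj w)"
    unfolding poisson_def w_def[symmetric] of_real_divide complex_norm_square[of w, symmetric] by simp
  ultimately show ?thesis
    using w \<open>z \<noteq> 0\<close> by (simp add: mobius_def w_def[symmetric] power2_eq_square)
qed

lemma poisson_pos:
  assumes "cmod lam < 1" "z \<in> circle"
  shows "poisson lam z > 0"
  unfolding poisson_def
proof (rule divide_pos_pos)
  show "0 < 1 - (cmod lam)\<^sup>2"
    using assms by (simp add: abs_square_less_1)
  show "0 < (cmod (1 - cnj lam * z))\<^sup>2"
    using mobius_denominator_nonzero[of lam z] assms by (intro zero_less_power) (simp del: right_minus_eq)
qed

text \<open>On the circle the condition on the kernel is the quadratic equation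
\<open>cnj lam * y\<^sup>2 - 2 * \<bar>lam\<bar>\<^sup>2 * y + lam = 0\<close>: a line meets the circle in at most two points.\<close>

lemma poisson_eq_1_at_most_twice:
  assumes lam: "0 < cmod lam" "cmod lam < 1"
    and y: "y1 \<in> circle" "y2 \<in> circle" "y3 \<in> circle" "y1 \<noteq> y2" "y1 \<noteq> y3" "y2 \<noteq> y3"
    and P: "poisson lam y1 = 1" "poisson lam y2 = 1" "poisson lam y3 = 1"
  shows False
proof -
  have quadratic: "cnj lam * y\<^sup>2 - 2 * (lam * cnj lam) * y + lam = 0"
    if "y \<in> circle" "poisson lam y = 1" for y
  proof -
    have yy: "y * cnj y = 1"
      using that(1) by (simp add: complex_norm_square[symmetric])
    have "(cmod (1 - cnj lam * y))\<^sup>2 = 1 - (cmod lam)\<^sup>2"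
      using that mobius_denominator_nonzero[of lam y] lam by (simp add: poisson_def)
    then have "complex_of_real ((cmod (1 - cnj lam * y))\<^sup>2) = complex_of_real (1 - (cmod lam)\<^sup>2)"
      by (rule arg_cong)
    then have "(1 - cnj lam * y) * (1 - lam * cnj y) = 1 - lam * cnj lam"
      unfolding of_real_diff complex_norm_square by simp
    then show ?thesis
      using yy by algebra
  qed
  have "(y1 - y2) * (cnj lam * (y1 + y2) - 2 * (lam * cnj lam)) = 0"
    "(y1 - y3) * (cnj lam * (y1 + y3) - 2 * (lam * cnj lam)) = 0"
    using quadratic[OF y(1) P(1)] quadratic[OF y(2) P(2)] quadratic[OF y(3) P(3)] by algebra+
  then have "cnj lam * (y1 + y2) = 2 * (lam * cnj lam)" "cnj lam * (y1 + y3) = 2 * (lam * cnj lam)"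
    using y by auto
  then have "cnj lam * (y2 - y3) = 0"
    by algebra
  then show False
    using lam y by auto
qed

section \<open>Conjugacy classes of the two families\<close>

lemma phi1_eq: "phi1 lam z = z\<^sup>2 * mobius lam z"
  by (simp add: phi1_def mobius_def)

lemma phi2_eq: "phi2 lam z = z * (mobius lam z)\<^sup>2"
  by (simp add: phi2_def mobius_def)

lemma phi1_has_field_derivative:
  assumes "(mobius lam has_field_derivative d) (at z)"
  shows "(phi1 lam has_field_derivative 2 * z * mobius lam z + z\<^sup>2 * d) (at z)"
  unfolding phi1_eq[abs_def] using assms by (auto intro!: derivative_eq_intros)

lemma phi2_has_field_derivative:
  assumes "(mobius lam has_field_derivative d) (at z)"
  shows "(phi2 lam has_field_derivative (mobius lam z)\<^sup>2 + 2 * z * mobius lam z * d) (at z)"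
  unfolding phi2_eq[abs_def] using assms by (auto intro!: derivative_eq_intros)

lemma phi1_not_C1_conjugate:
  assumes "0 < cmod lam" "cmod lam < 1"
  shows "\<not> C1_conjugate (phi1 lam) phi0"
proof (rule not_C1_conjugate_phi0[where L = "\<lambda>z. 2 + poisson lam z" and ?n2.0 = "- lam" and ?n1.0 = 0
      and ?d1.0 = "- cnj lam" and ?d2.0 = 0])
  fix z :: complex
  show "phi1 lam z = (z ^ 3 + - lam * z\<^sup>2 + 0 * z) / (1 + - cnj lam * z + 0 * z\<^sup>2)"
    by (simp add: phi1_def power2_eq_square power3_eq_cube algebra_simps)
  assume z: "z \<in> circle"
  then have w: "1 - cnj lam * z \<noteq> 0"
    using assms by (intro mobius_denominator_nonzero) auto
  then show "1 + - cnj lam * z + 0 * z\<^sup>2 \<noteq> 0"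
    by simp
  show "phi1 lam z \<in> circle"
    using cmod_mobius_circle[OF assms(2) z] z by (simp add: phi1_eq norm_mult norm_power)
  show "2 + poisson lam z > 0"
    using poisson_pos[OF assms(2) z] by simp
  have "z \<noteq> 0"
    using z by auto
  then have "2 * z * mobius lam z + z\<^sup>2 * (mobius lam z * of_real (poisson lam z) / z)
      = phi1 lam z * of_real (2 + poisson lam z) / z"
    by (simp add: phi1_eq power2_eq_square field_simps)
  then show "(phi1 lam has_field_derivative phi1 lam z * of_real (2 + poisson lam z) / z) (at z)"
    using phi1_has_field_derivative[OF mobius_has_field_derivative[OF w]]
    by (simp only: mobius_derivative_circle[OF assms(2) z])
next
  fix y1 y2 y3
  assume "y1 \<in> circle" "y2 \<in> circle" "y3 \<in> circle" "y1 \<noteq> y2" "y1 \<noteq> y3" "y2 \<noteq> y3"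
    "2 + poisson lam y1 = 3" "2 + poisson lam y2 = 3" "2 + poisson lam y3 = 3"
  then show False
    using poisson_eq_1_at_most_twice[OF assms, of y1 y2 y3] by auto
qed

lemma phi2_not_C1_conjugate:
  assumes "0 < cmod lam" "cmod lam < 1"
  shows "\<not> C1_conjugate (phi2 lam) phi0"
proof (rule not_C1_conjugate_phi0[where L = "\<lambda>z. 1 + 2 * poisson lam z" and ?n2.0 = "- 2 * lam" and ?n1.0 = "lam\<^sup>2"
      and ?d1.0 = "- 2 * cnj lam" and ?d2.0 = "(cnj lam)\<^sup>2"])
  fix z :: complex
  have sq: "1 + - 2 * cnj lam * z + (cnj lam)\<^sup>2 * z\<^sup>2 = (1 - cnj lam * z)\<^sup>2"
    by (simp add: power2_eq_square algebra_simps)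
  show "phi2 lam z = (z ^ 3 + - 2 * lam * z\<^sup>2 + lam\<^sup>2 * z) / (1 + - 2 * cnj lam * z + (cnj lam)\<^sup>2 * z\<^sup>2)"
    unfolding sq phi2_def power_divide times_divide_eq_right
    by (simp add: power2_eq_square power3_eq_cube algebra_simps)
  assume z: "z \<in> circle"
  then have w: "1 - cnj lam * z \<noteq> 0"
    using assms by (intro mobius_denominator_nonzero) auto
  then show "1 + - 2 * cnj lam * z + (cnj lam)\<^sup>2 * z\<^sup>2 \<noteq> 0"
    unfolding sq by simp
  show "phi2 lam z \<in> circle"
    using cmod_mobius_circle[OF assms(2) z] z by (simp add: phi2_eq norm_mult norm_power)
  show "1 + 2 * poisson lam z > 0"
    using poisson_pos[OF assms(2) z] by simp
  have "z \<noteq> 0"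
    using z by auto
  then have "(mobius lam z)\<^sup>2 + 2 * z * mobius lam z * (mobius lam z * of_real (poisson lam z) / z)
      = phi2 lam z * of_real (1 + 2 * poisson lam z) / z"
    by (simp add: phi2_eq power2_eq_square field_simps)
  then show "(phi2 lam has_field_derivative phi2 lam z * of_real (1 + 2 * poisson lam z) / z) (at z)"
    using phi2_has_field_derivative[OF mobius_has_field_derivative[OF w]]
    by (simp only: mobius_derivative_circle[OF assms(2) z])
next
  fix y1 y2 y3
  assume "y1 \<in> circle" "y2 \<in> circle" "y3 \<in> circle" "y1 \<noteq> y2" "y1 \<noteq> y3" "y2 \<noteq> y3"
    "1 + 2 * poisson lam y1 = 3" "1 + 2 * poisson lam y2 = 3" "1 + 2 * poisson lam y3 = 3"
  then show False
    using poisson_eq_1_at_most_twice[OF assms, of y1 y2 y3] by auto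
qed

section \<open>Distance to the cube map\<close>

lemma mobius_near_identity:
  assumes lam: "cmod lam < 1/2" and z: "z \<in> circle"
  shows "cmod (mobius lam z - z) \<le> 4 * cmod lam"
    and "cmod ((1 - of_real ((cmod lam)\<^sup>2)) / (1 - cnj lam * z)\<^sup>2 - 1) \<le> 12 * cmod lam"
proof -
  define w where "w = 1 - cnj lam * z"
  have "cmod (1 - cnj lam * z) \<ge> 1 - cmod (cnj lam * z)"
    using norm_triangle_ineq2[of 1 "cnj lam * z"] by simp
  then have w: "cmod w \<ge> 1/2"
    using lam z by (simp add: w_def norm_mult)
  then have w0: "w \<noteq> 0" by auto
  have "cnj lam * z\<^sup>2 - lam = (z - lam) - z * w"
    by (simp add: w_def power2_eq_square algebra_simps)
  then have "mobius lam z - z = (cnj lam * z\<^sup>2 - lam) / w"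
    using w0 by (simp add: mobius_def w_def[symmetric] diff_divide_distrib)
  moreover have "cmod (cnj lam * z\<^sup>2 - lam) \<le> 2 * cmod lam"
    using norm_triangle_ineq4[of "cnj lam * z\<^sup>2" lam] z by (simp add: norm_mult norm_power)
  ultimately have "cmod (mobius lam z - z) \<le> 2 * cmod lam / (1/2)"
    unfolding norm_divide using w by (simp only: norm_divide) (intro frac_le, auto)
  then show "cmod (mobius lam z - z) \<le> 4 * cmod lam"
    by simp
  have "2 * (cnj lam * z) - (cnj lam * z)\<^sup>2 - of_real ((cmod lam)\<^sup>2)
      = (1 - of_real ((cmod lam)\<^sup>2)) - w\<^sup>2"
    by (simp add: w_def power2_eq_square algebra_simps)
  then have "(1 - of_real ((cmod lam)\<^sup>2)) / w\<^sup>2 - 1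
      = (2 * (cnj lam * z) - (cnj lam * z)\<^sup>2 - of_real ((cmod lam)\<^sup>2)) / w\<^sup>2"
    using w0 by (simp only: diff_divide_distrib) simp
  moreover have "cmod (2 * (cnj lam * z) - (cnj lam * z)\<^sup>2 - of_real ((cmod lam)\<^sup>2)) \<le> 3 * cmod lam"
  proof -
    have "cmod (2 * (cnj lam * z) - (cnj lam * z)\<^sup>2 - of_real ((cmod lam)\<^sup>2))
        \<le> cmod (2 * (cnj lam * z)) + cmod ((cnj lam * z)\<^sup>2) + cmod (of_real ((cmod lam)\<^sup>2))"
      by (meson add_mono_thms_linordered_semiring(3) norm_triangle_ineq4 order_trans)
    also have "\<dots> = 2 * cmod lam + 2 * (cmod lam)\<^sup>2"
      using z by (simp add: norm_mult norm_power)
    also have "\<dots> \<le> 3 * cmod lam"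
      using mult_right_mono[of "cmod lam" "1/2" "cmod lam"] lam by (simp add: power2_eq_square)
    finally show ?thesis .
  qed
  moreover have "cmod w ^ 2 \<ge> (1/2) ^ 2"
    using w by (intro power_mono) auto
  ultimately have "cmod ((1 - of_real ((cmod lam)\<^sup>2)) / w\<^sup>2 - 1) \<le> 3 * cmod lam / (1/2) ^ 2"
    by (simp only: norm_divide norm_power) (intro frac_le, auto)
  then show "cmod ((1 - of_real ((cmod lam)\<^sup>2)) / (1 - cnj lam * z)\<^sup>2 - 1) \<le> 12 * cmod lam"
    by (simp add: w_def power2_eq_square)
qed

lemma dist_C1_le:
  assumes "\<And>z. z \<in> circle \<Longrightarrow> cmod (\<phi> z - \<psi> z) \<le> A"
    and "\<And>z. z \<in> circle \<Longrightarrow> (\<phi> has_field_derivative \<phi>' z) (at z)"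
    and "\<And>z. z \<in> circle \<Longrightarrow> (\<psi> has_field_derivative \<psi>' z) (at z)"
    and "\<And>z. z \<in> circle \<Longrightarrow> cmod (\<phi>' z - \<psi>' z) \<le> B"
  shows "dist_C1 \<phi> \<psi> \<le> A + B"
proof -
  have "circle_deriv \<phi> z = \<phi>' z" "circle_deriv \<psi> z = \<psi>' z" if "z \<in> circle" for z
    using assms(2,3)[OF that] that by (auto intro: circle_deriv_eqI has_field_derivative_at_within)
  then show ?thesis
    unfolding dist_C1_def using assms(1,4) by (intro add_mono cSUP_least) auto
qed

lemma phi_near_phi0:
  assumes lam: "cmod lam < 1/2"
  shows "dist_C1 (phi1 lam) phi0 \<le> 48 * cmod lam" "dist_C1 (phi2 lam) phi0 \<le> 48 * cmod lam"
proof -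
  define b where "b = mobius lam"
  define b' where "b' z = (1 - of_real ((cmod lam)\<^sup>2)) / (1 - cnj lam * z)\<^sup>2" for z
  define l where "l = cmod lam"
  have l: "l \<ge> 0"
    by (simp add: l_def)
  have b1: "cmod (b z) = 1" if "z \<in> circle" for z
    using cmod_mobius_circle[of lam z] lam that by (simp add: b_def)
  have bz: "cmod (b z - z) \<le> 4 * l" and b'1: "cmod (b' z - 1) \<le> 12 * l" if "z \<in> circle" for z
    unfolding b_def b'_def l_def using mobius_near_identity[OF lam that] by auto
  have bz2: "cmod ((b z - z) * (b z + z)) \<le> 8 * l" if "z \<in> circle" for z
  proof -
    have "cmod (b z + z) \<le> 2"
      using norm_triangle_ineq[of "b z" z] b1[OF that] that by simp
    then have "cmod (b z - z) * cmod (b z + z) \<le> (4 * l) * 2"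
      using bz[OF that] l by (intro mult_mono) auto
    then show ?thesis
      by (simp add: norm_mult)
  qed
  have deriv_b: "(mobius lam has_field_derivative b' z) (at z)" if "z \<in> circle" for z
    unfolding b'_def using that lam by (intro mobius_has_field_derivative mobius_denominator_nonzero) auto
  have deriv0: "(phi0 has_field_derivative 3 * z\<^sup>2) (at z)" for z
    unfolding phi0_def[abs_def] by (auto intro!: derivative_eq_intros)
  have "dist_C1 (phi1 lam) phi0 \<le> 4 * l + 20 * l"
  proof (rule dist_C1_le[OF _ phi1_has_field_derivative[OF deriv_b] deriv0])
    fix z :: complex assume z: "z \<in> circle"
    have "phi1 lam z - phi0 z = z\<^sup>2 * (b z - z)"
      unfolding phi1_eq phi0_def b_def by algebra
    then show "cmod (phi1 lam z - phi0 z) \<le> 4 * l"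
      using bz[OF z] z by (simp add: norm_mult norm_power)
    have "2 * z * mobius lam z + z\<^sup>2 * b' z - 3 * z\<^sup>2 = 2 * z * (b z - z) + z\<^sup>2 * (b' z - 1)"
      unfolding b_def by algebra
    also have "cmod \<dots> \<le> 2 * cmod (b z - z) + cmod (b' z - 1)"
      by (rule norm_triangle_le) (use z in \<open>simp add: norm_mult norm_power\<close>)
    finally show "cmod (2 * z * mobius lam z + z\<^sup>2 * b' z - 3 * z\<^sup>2) \<le> 20 * l"
      using bz[OF z] b'1[OF z] by linarith
  qed
  then show "dist_C1 (phi1 lam) phi0 \<le> 48 * cmod lam"
    using l unfolding l_def by linarith
  have "dist_C1 (phi2 lam) phi0 \<le> 8 * l + 40 * l"
  proof (rule dist_C1_le[OF _ phi2_has_field_derivative[OF deriv_b] deriv0])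
    fix z :: complex assume z: "z \<in> circle"
    have "phi2 lam z - phi0 z = z * ((b z - z) * (b z + z))"
      unfolding phi2_eq phi0_def b_def by algebra
    then show "cmod (phi2 lam z - phi0 z) \<le> 8 * l"
      using bz2[OF z] z by (simp add: norm_mult[of z])
    have "(mobius lam z)\<^sup>2 + 2 * z * mobius lam z * b' z - 3 * z\<^sup>2
        = (b z - z) * (b z + z) + (2 * z * (b z - z) + 2 * z * b z * (b' z - 1))"
      unfolding b_def by algebra
    also have "cmod \<dots> \<le> cmod ((b z - z) * (b z + z)) + (2 * cmod (b z - z) + 2 * cmod (b' z - 1))"
      by (intro norm_triangle_le add_left_mono) (use z b1[OF z] in \<open>simp add: norm_mult norm_power\<close>)
    finally show "cmod ((mobius lam z)\<^sup>2 + 2 * z * mobius lam z * b' z - 3 * z\<^sup>2) \<le> 40 * l"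
      using bz[OF z] bz2[OF z] b'1[OF z] by linarith
  qed
  then show "dist_C1 (phi2 lam) phi0 \<le> 48 * cmod lam"
    using l unfolding l_def by linarith
qed

section \<open>Mixing and conjugacy of the two families\<close>

lemma inner_factor_mobius:
  assumes "cmod lam < 1"
  shows "inner_factor (mobius lam)"
  unfolding inner_factor_def
proof (intro conjI ballI)
  have "open {z. 1 - cnj lam * z \<noteq> 0}"
    by (intro open_Collect_neq continuous_intros)
  moreover have "cball 0 1 \<subseteq> {z. 1 - cnj lam * z \<noteq> 0}"
    using mobius_denominator_nonzero[OF assms] by auto
  moreover have "mobius lam holomorphic_on {z. 1 - cnj lam * z \<noteq> 0}"
    unfolding mobius_def[abs_def] by (intro holomorphic_intros) auto
  ultimately show "\<exists>U. open U \<and> cball 0 1 \<subseteq> U \<and> mobius lam holomorphic_on U"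
    by blast
qed (use assms cmod_mobius_le cmod_mobius_circle in auto)

lemma inner_factor_power:
  assumes "inner_factor b"
  shows "inner_factor (\<lambda>z. b z ^ n)"
  using assms unfolding inner_factor_def
  by (auto simp: norm_power power_le_one intro: holomorphic_on_power)

theorem proposition6p1:
  shows "(\<forall>lam. 0 < cmod lam \<and> cmod lam < 1 \<longrightarrow>
            double_exp_mixing (phi1 lam) \<and> \<not> double_exp_mixing (phi2 lam)) \<and>
         (\<exists>C \<delta> :: real. C > 0 \<and> 0 < \<delta> \<and> \<delta> < 1 \<and>
            (\<forall>lam. 0 < cmod lam \<and> cmod lam < \<delta> \<longrightarrow>
               dist_C1 (phi1 lam) phi0 \<le> C * cmod lam \<and> dist_C1 (phi2 lam) phi0 \<le> C * cmod lam)) \<and>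
         (\<forall>lam. 0 < cmod lam \<and> cmod lam < 1 \<longrightarrow>
            \<not> C1_conjugate (phi1 lam) phi0 \<and> \<not> C1_conjugate (phi2 lam) phi0)"
proof (intro conjI allI impI)
  fix lam :: complex
  assume lam: "0 < cmod lam \<and> cmod lam < 1"
  then have b: "inner_factor (mobius lam)"
    by (intro inner_factor_mobius) simp
  show "double_exp_mixing (phi1 lam)"
    by (rule double_exp_mixing_critical_fixed_point[OF b order_refl phi1_eq])
  show "\<not> double_exp_mixing (phi2 lam)"
  proof (rule not_double_exp_mixing_noncritical_fixed_point[OF inner_factor_power[OF b] phi2_eq])
    show "(mobius lam 0)\<^sup>2 \<noteq> 0"
      using lam by (auto simp: mobius_def)
  qed
  show "\<not> C1_conjugate (phi1 lam) phi0" "\<not> C1_conjugate (phi2 lam) phi0"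
    using lam phi1_not_C1_conjugate phi2_not_C1_conjugate by auto
next
  show "\<exists>C \<delta> :: real. C > 0 \<and> 0 < \<delta> \<and> \<delta> < 1 \<and>
      (\<forall>lam. 0 < cmod lam \<and> cmod lam < \<delta> \<longrightarrow>
         dist_C1 (phi1 lam) phi0 \<le> C * cmod lam \<and> dist_C1 (phi2 lam) phi0 \<le> C * cmod lam)"
    using phi_near_phi0 by (intro exI[of _ 48] exI[of _ "1/2"]) auto
qed

end
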